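(* Let $\{p_j\}_{j\ge 0}$ be polynomials orthogonal on the real line with respect to a measure $\mu$ with $\operatorname{supp}\mu\subseteq\mathbb{R}$, and let $n\ge 0$ be a fixed integer. For the random orthogonal polynomial $P_n(z)=\sum_{j=0}^n\eta_j p_j(z)$, where $\eta_j=\alpha_j+i\beta_j$ and $\alpha_0,\dots,\alpha_n,\beta_0,\dots,\beta_n$ are independent real standard normal random variables, the intensity function $$h_n^P(z)=\frac{K_n^{(1,1)}(z,z)\,K_n(z,z)-\left|K_n^{(0,1)}(z,z)\right|^2}{\pi\left(K_n(z,z)\right)^2}$$ of the zeros of $P_n$ simplifies to $$h_n^P(z)=\frac{1}{4\pi\left(\operatorname{Im}(z)\right)^2}-\frac{\left|p_{n+1}'(z)p_n(z)-p_n'(z)p_{n+1}(z)\right|^2}{4\pi\left(\operatorname{Im}\left(p_{n+1}(z)p_n(\bar z)\right)\right)^2},\qquad z\in\mathbb{C},$$ where at real $z$ (where the denominators vanish and the singularities cancel) the right-hand side is understood as its continuous extension.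
   Context: The polynomials $\{p_j\}_{j\ge0}$ are orthogonal on the real line with respect to $\mu$ if $p_j$ is a polynomial of exact degree $j$ with real coefficients and $\int p_k(x)p_m(x)\,d\mu(x)=\delta_{km}$ for all $k,m\in\mathbb{N}\cup\{0\}$. The kernels are $$K_n(z,w)=\sum_{j=0}^n p_j(z)\overline{p_j(w)},\qquad K_n^{(0,1)}(z,w)=\sum_{j=0}^n p_j(z)\overline{p_j'(w)},\qquad K_n^{(1,1)}(z,w)=\sum_{j=0}^n p_j'(z)\overline{p_j'(w)}.$$ Since $p_0$ is a nonzero constant, $K_n(z,z)>0$ for all $z\in\mathbb{C}$. *)

theory Defs
  imports "HOL-Probability.Probability" "HOL-Computational_Algebra.Polynomial"
begin

text \<open>
  Since \<open>\<mu>\<close> is a measure on the real type, the condition that its support is contained in the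
  real line is built in. Exact degree 0 also requires \<open>p 0 \<noteq> 0\<close>, as \<^term>\<open>degree 0 = 0\<close>.
\<close>

definition orthogonal_on_real_line :: "real measure \<Rightarrow> (nat \<Rightarrow> real poly) \<Rightarrow> bool" where
  "orthogonal_on_real_line \<mu> p \<longleftrightarrow>
     sets \<mu> = sets borel \<and>
     (\<forall>j. p j \<noteq> 0 \<and> degree (p j) = j) \<and>
     (\<forall>k m. integrable \<mu> (\<lambda>x. poly (p k) x * poly (p m) x) \<and>
            (\<integral>x. poly (p k) x * poly (p m) x \<partial>\<mu>) = (if k = m then 1 else 0))"

abbreviation cpoly :: "real poly \<Rightarrow> complex poly" where
  "cpoly q \<equiv> map_poly complex_of_real q"

definition K :: "(nat \<Rightarrow> real poly) \<Rightarrow> nat \<Rightarrow> complex \<Rightarrow> complex \<Rightarrow> complex" where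
  "K p n z w = (\<Sum>j\<le>n. poly (cpoly (p j)) z * cnj (poly (cpoly (p j)) w))"

definition K01 :: "(nat \<Rightarrow> real poly) \<Rightarrow> nat \<Rightarrow> complex \<Rightarrow> complex \<Rightarrow> complex" where
  "K01 p n z w = (\<Sum>j\<le>n. poly (cpoly (p j)) z * cnj (poly (pderiv (cpoly (p j))) w))"

definition K11 :: "(nat \<Rightarrow> real poly) \<Rightarrow> nat \<Rightarrow> complex \<Rightarrow> complex \<Rightarrow> complex" where
  "K11 p n z w =
     (\<Sum>j\<le>n. poly (pderiv (cpoly (p j))) z * cnj (poly (pderiv (cpoly (p j))) w))"

text \<open>The values are in fact real and nonnegative.\<close>

definition hP :: "(nat \<Rightarrow> real poly) \<Rightarrow> nat \<Rightarrow> complex \<Rightarrow> complex" where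
  "hP p n z =
     (K11 p n z z * K p n z z - complex_of_real ((cmod (K01 p n z z))\<^sup>2)) /
     (complex_of_real pi * (K p n z z)\<^sup>2)"

definition random_poly ::
  "(nat \<Rightarrow> real poly) \<Rightarrow> nat \<Rightarrow> (nat \<Rightarrow> 'a \<Rightarrow> real) \<Rightarrow> (nat \<Rightarrow> 'a \<Rightarrow> real) \<Rightarrow> 'a \<Rightarrow> complex poly" where
  "random_poly p n \<alpha> \<beta> \<omega> =
     (\<Sum>j\<le>n. smult (complex_of_real (\<alpha> j \<omega>) + \<i> * complex_of_real (\<beta> j \<omega>)) (cpoly (p j)))"

text \<open>
  \<open>\<alpha> 0, \<dots>, \<alpha> n, \<beta> 0, \<dots>, \<beta> n\<close> form one jointly independent family, indexed by the disjoint
  union of two copies of \<open>{..n}\<close>.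
\<close>

definition indep_std_normals ::
  "'a measure \<Rightarrow> nat \<Rightarrow> (nat \<Rightarrow> 'a \<Rightarrow> real) \<Rightarrow> (nat \<Rightarrow> 'a \<Rightarrow> real) \<Rightarrow> bool" where
  "indep_std_normals M n \<alpha> \<beta> \<longleftrightarrow>
     prob_space.indep_vars M (\<lambda>_. borel) (case_sum \<alpha> \<beta>) ({..n} <+> {..n}) \<and>
     (\<forall>j\<le>n. distributed M lborel (\<alpha> j) std_normal_density \<and>
             distributed M lborel (\<beta> j) std_normal_density)"

text \<open>
  \<open>h\<close> is a density, with respect to planar Lebesgue measure, of the expected number of zeros
  of the random polynomial \<open>P\<close>. Zeros are counted with multiplicity; the zero polynomial (a null
  event for the polynomials considered here) counts as having none, as \<^term>\<open>proots 0 = {#}\<close>.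
\<close>

definition is_zero_intensity :: "'a measure \<Rightarrow> ('a \<Rightarrow> complex poly) \<Rightarrow> (complex \<Rightarrow> real) \<Rightarrow> bool" where
  "is_zero_intensity M P h \<longleftrightarrow>
     h \<in> borel_measurable borel \<and> (\<forall>z. 0 \<le> h z) \<and>
     (\<forall>A \<in> sets (borel :: complex measure).
        (\<integral>\<^sup>+ \<omega>. of_nat (size (filter_mset (\<lambda>z. z \<in> A) (proots (P \<omega>)))) \<partial>M) =
        (\<integral>\<^sup>+ z \<in> A. ennreal (h z) \<partial>lborel))"

definition simplified_hP :: "(nat \<Rightarrow> real poly) \<Rightarrow> nat \<Rightarrow> complex \<Rightarrow> real" where
  "simplified_hP p n z =
     1 / (4 * pi * (Im z)\<^sup>2) -
     (cmod (poly (pderiv (cpoly (p (n + 1)))) z * poly (cpoly (p n)) z -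
            poly (pderiv (cpoly (p n))) z * poly (cpoly (p (n + 1))) z))\<^sup>2 /
     (4 * pi * (Im (poly (cpoly (p (n + 1))) z * poly (cpoly (p n)) (cnj z)))\<^sup>2)"

end

theory Submission
  imports Defs "HOL-Complex_Analysis.Complex_Analysis"
    "HOL-Computational_Algebra.Fundamental_Theorem_Algebra"
begin

text \<open>
  The proof has two independent parts: that \<open>hP\<close> is the intensity of the zeros, and that it has the
  simplified form.

  For the intensity, let \<open>P\<close> be the random polynomial and \<open>K(z) = K\<^sub>n(z, z)\<close>. The number of zeros of \<open>P\<close> in a
  rectangle is the integral of \<open>P'(z) / P(z) dz / (2 \<pi> \<i>)\<close> around its boundary
  (\<open>boundary_integral_logarithmic_derivative\<close>). At a fixed \<open>z\<close> the pair \<open>(P'(z), P(z))\<close> is Gaussian, and the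
  mean of the quotient is the regression coefficient, \<open>E (P'(z) / P(z)) = \<partial>\<^sub>z log K(z)\<close>
  (\<open>expectation_quotient\<close>). So by Fubini the expected number of zeros is the boundary integral of
  \<open>\<partial>\<^sub>z log K\<close> over \<open>2 \<pi> \<i>\<close>, and Green's formula (\<open>boundary_integral_green\<close>) turns it into the integral over
  the rectangle of \<open>1 / \<pi>\<close> times the derivative of \<open>\<partial>\<^sub>z log K\<close> in \<open>cnj z\<close>, which is \<open>hP\<close>. Rectangles determine
  the measure (\<open>expected_zeros\<close>).

  Both the Gaussian mean and its integrability rest on the unitary invariance of the product of two
  complex Gaussian measures (\<open>cgauss_unitary_invariant\<close>): it gives the law of every linear combination of
  the coefficients, and it reduces a quotient of two combinations to a constant plus a multiple of
  \<open>v / u\<close> with \<open>u\<close>, \<open>v\<close> independent, which has mean \<open>0\<close>. The function \<open>1 / \<bar>u\<bar>\<close> is integrable in the plane but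
  \<open>1 / \<bar>t\<bar>\<close> is not on a line; therefore the means exist and yet almost surely no zero of \<open>P\<close> lies on the
  boundary of a given rectangle (\<open>AE_no_zero_on_segment\<close>).

  For the simplified form, the Christoffel--Darboux formula shows that off the real line \<open>K(z)\<close> is a
  constant multiple of \<open>Im (p\<^sub>n\<^sub>+\<^sub>1(z) p\<^sub>n(cnj z)) / Im z\<close>. Taking logarithms, the denominator contributes
  \<open>1 / (4 \<pi> (Im z)\<^sup>2)\<close> to the intensity and the numerator contributes the Wronskian term
  (\<open>christoffel_darboux_wronskian\<close>, \<open>hP_eq_simplified\<close>).
\<close>

section \<open>Real polynomials at complex points\<close>

lemma poly_cpoly_pCons: "poly (cpoly (pCons a q)) z = of_real a + z * poly (cpoly q) z"
  by (simp add: map_poly_pCons)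

lemma poly_cpoly_add: "poly (cpoly (q + r)) z = poly (cpoly q) z + poly (cpoly r) z"
proof -
  have "cpoly (q + r) = cpoly q + cpoly r"
    by (rule poly_eqI) (simp add: coeff_map_poly)
  then show ?thesis by simp
qed

lemma poly_cpoly_smult: "poly (cpoly (smult c q)) z = of_real c * poly (cpoly q) z"
proof -
  have "cpoly (smult c q) = smult (of_real c) (cpoly q)"
    by (rule poly_eqI) (simp add: coeff_map_poly)
  then show ?thesis by simp
qed

lemma poly_cpoly_sum: "poly (cpoly (\<Sum>k\<in>I. f k)) z = (\<Sum>k\<in>I. poly (cpoly (f k)) z)"
  by (induction I rule: infinite_finite_induct) (simp_all add: poly_cpoly_add)

lemma cnj_poly_cpoly: "cnj (poly (cpoly q) z) = poly (cpoly q) (cnj z)"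
  by (induction q) (simp_all add: poly_cpoly_pCons)

lemma pderiv_cpoly: "pderiv (cpoly q) = cpoly (pderiv q)"
  by (rule poly_eqI) (simp add: coeff_map_poly coeff_pderiv)

lemma cnj_poly_pderiv_cpoly:
  "cnj (poly (pderiv (cpoly q)) z) = poly (pderiv (cpoly q)) (cnj z)"
  by (simp add: pderiv_cpoly cnj_poly_cpoly)

section \<open>The Christoffel--Darboux formula\<close>

text \<open>
  Needed to expand \<open>x p\<^sub>j\<close> in the \<open>p\<^sub>k\<close>; the leading coefficient is removed at each step.
\<close>

lemma poly_expansion_exact_degrees:
  fixes p :: "nat \<Rightarrow> 'a::field poly"
  assumes "\<And>j. p j \<noteq> 0" "\<And>j. degree (p j) = j"
  shows "degree q \<le> d \<Longrightarrow> \<exists>c. q = (\<Sum>k\<le>d. smult (c k) (p k))"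
proof (induction d arbitrary: q)
  case 0
  then obtain a where "q = [:a:]" by (auto elim: degree_eq_zeroE)
  moreover obtain b where "p 0 = [:b:]" using assms(2)[of 0] by (auto elim: degree_eq_zeroE)
  moreover have "b \<noteq> 0" using assms(1)[of 0] calculation by auto
  ultimately show ?case by (intro exI[of _ "\<lambda>_. a / b"]) simp
next
  case (Suc d)
  define a where "a = coeff q (Suc d) / coeff (p (Suc d)) (Suc d)"
  have lc: "coeff (p (Suc d)) (Suc d) \<noteq> 0"
    using assms(1)[of "Suc d"] assms(2)[of "Suc d"] by (metis leading_coeff_0_iff)
  have "degree (q - smult a (p (Suc d))) \<le> d"
  proof (rule degree_le, intro allI impI)
    fix i assume "i > d"
    show "coeff (q - smult a (p (Suc d))) i = 0"
    proof (cases "i = Suc d")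
      case True
      then show ?thesis using lc by (simp add: a_def)
    next
      case False
      then have "degree q < i" "degree (p (Suc d)) < i"
        using \<open>i > d\<close> Suc.prems assms(2)[of "Suc d"] by auto
      then show ?thesis by (simp add: coeff_eq_0)
    qed
  qed
  from Suc.IH[OF this] obtain c where c: "q - smult a (p (Suc d)) = (\<Sum>k\<le>d. smult (c k) (p k))"
    by blast
  have "q = (\<Sum>k\<le>Suc d. smult ((c(Suc d := a)) k) (p k))"
  proof -
    have "(\<Sum>k\<le>d. smult ((c(Suc d := a)) k) (p k)) = (\<Sum>k\<le>d. smult (c k) (p k))"
      by (rule sum.cong) auto
    then show ?thesis using c by (simp add: algebra_simps)
  qed
  then show ?case by blast
qed

text \<open>
  Multiplication by \<open>x\<close> is symmetric for the inner product of \<open>L\<^sup>2(\<mu>)\<close>, so its matrix \<open>J\<close> in the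
  basis \<open>p\<close> is symmetric, and it vanishes far above the diagonal by degree: \<open>J\<close> is the Jacobi matrix,
  and its tridiagonality is the three-term recurrence.
\<close>

lemma jacobi_matrix:
  assumes "orthogonal_on_real_line \<mu> p"
  obtains J :: "nat \<Rightarrow> nat \<Rightarrow> real" where
    "\<And>j. pCons 0 (p j) = (\<Sum>k\<le>Suc j. smult (J j k) (p k))"
    "\<And>j k. J j k = J k j"
    "\<And>j k. Suc j < k \<Longrightarrow> J j k = 0"
proof -
  have nz: "\<And>j. p j \<noteq> 0" and deg: "\<And>j. degree (p j) = j"
    and int: "\<And>k m. integrable \<mu> (\<lambda>x. poly (p k) x * poly (p m) x)"
    and orth: "\<And>k m. (\<integral>x. poly (p k) x * poly (p m) x \<partial>\<mu>) = (if k = m then 1 else 0)"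
    using assms unfolding orthogonal_on_real_line_def by auto
  have "\<exists>c. pCons 0 (p j) = (\<Sum>k\<le>Suc j. smult (c k) (p k))" for j
    by (rule poly_expansion_exact_degrees) (use nz deg degree_pCons_le[of 0 "p j"] in auto)
  then obtain c where c: "\<And>j. pCons 0 (p j) = (\<Sum>k\<le>Suc j. smult (c j k) (p k))"
    by metis
  define J where "J j k = (if k \<le> Suc j then c j k else 0)" for j k
  have exp: "pCons 0 (p j) = (\<Sum>k\<le>Suc j. smult (J j k) (p k))" for j
    using c[of j] by (simp add: J_def)
  have J_int: "(\<integral>x. x * poly (p j) x * poly (p m) x \<partial>\<mu>) = J j m" for j m
  proof -
    have "x * poly (p j) x = (\<Sum>k\<le>Suc j. J j k * poly (p k) x)" for x
    proof -
      have "x * poly (p j) x = poly (pCons 0 (p j)) x" by simp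
      also have "\<dots> = (\<Sum>k\<le>Suc j. J j k * poly (p k) x)"
        unfolding exp by (simp only: poly_sum poly_smult)
      finally show ?thesis .
    qed
    then have "(\<integral>x. x * poly (p j) x * poly (p m) x \<partial>\<mu>)
        = (\<integral>x. (\<Sum>k\<le>Suc j. J j k * (poly (p k) x * poly (p m) x)) \<partial>\<mu>)"
      by (simp only: sum_distrib_right mult.assoc)
    also have "\<dots> = (\<Sum>k\<le>Suc j. J j k * (if k = m then 1 else 0))"
      using int by (subst Bochner_Integration.integral_sum) (auto simp: orth simp del: sum.atMost_Suc)
    also have "\<dots> = J j m"
      by (simp add: J_def if_distrib cong: if_cong)
    finally show ?thesis .
  qed
  have "J j k = J k j" for j k
    unfolding J_int[symmetric] by (simp add: mult_ac)
  moreover have "Suc j < k \<Longrightarrow> J j k = 0" for j k by (simp add: J_def)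
  ultimately show ?thesis using exp that by blast
qed

text \<open>
  Replacing \<open>z p\<^sub>j(z)\<close> and \<open>w p\<^sub>j(w)\<close> by their expansions, the terms with both indices at most \<open>n\<close>
  cancel by the symmetry of \<open>J\<close>, and tridiagonality leaves only \<open>J n (n + 1)\<close>. The variable \<open>w\<close> is not
  conjugated, so both sides are polynomials in two variables and can be differentiated in each.
\<close>

lemma christoffel_darboux:
  assumes "orthogonal_on_real_line \<mu> p"
  obtains c :: complex where
    "\<And>z w. (z - w) * (\<Sum>j\<le>n. poly (cpoly (p j)) z * poly (cpoly (p j)) w) =
       c * (poly (cpoly (p (Suc n))) z * poly (cpoly (p n)) w
            - poly (cpoly (p n)) z * poly (cpoly (p (Suc n))) w)"
proof -
  obtain J where exp: "\<And>j. pCons 0 (p j) = (\<Sum>k\<le>Suc j. smult (J j k) (p k))"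
    and sym: "\<And>j k. J j k = J k j" and band: "\<And>j k. Suc j < k \<Longrightarrow> J j k = 0"
    by (rule jacobi_matrix[OF assms]) blast
  define e where "e j z = poly (cpoly (p j)) z" for j z
  have "(z - w) * (\<Sum>j\<le>n. e j z * e j w) = of_real (J n (Suc n)) * (e (Suc n) z * e n w - e n z * e (Suc n) w)"
    for z w
  proof -
    have mult: "z * e j z = (\<Sum>k\<le>Suc n. of_real (J j k) * e k z)" if "j \<le> n" for j z
    proof -
      have "z * e j z = poly (cpoly (pCons 0 (p j))) z"
        by (simp add: poly_cpoly_pCons e_def)
      also have "\<dots> = (\<Sum>k\<le>Suc j. of_real (J j k) * e k z)"
        unfolding exp by (simp only: poly_cpoly_sum poly_cpoly_smult e_def)
      also have "\<dots> = (\<Sum>k\<le>Suc n. of_real (J j k) * e k z)"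
        using that by (intro sum.mono_neutral_left) (auto simp: band)
      finally show ?thesis .
    qed
    have "(z - w) * (\<Sum>j\<le>n. e j z * e j w) = (\<Sum>j\<le>n. (z * e j z) * e j w - e j z * (w * e j w))"
      unfolding sum_distrib_left by (rule sum.cong) (auto simp: algebra_simps)
    also have "\<dots> = (\<Sum>j\<le>n. \<Sum>k\<le>Suc n. of_real (J j k) * (e k z * e j w - e j z * e k w))"
      by (rule sum.cong) (auto simp: mult sum_distrib_left sum_distrib_right sum_subtractf
          algebra_simps simp del: sum.atMost_Suc)
    also have "\<dots> = (\<Sum>j\<le>n. \<Sum>k\<le>n. of_real (J j k) * (e k z * e j w - e j z * e k w))
        + (\<Sum>j\<le>n. of_real (J j (Suc n)) * (e (Suc n) z * e j w - e j z * e (Suc n) w))"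
      by (simp add: sum.distrib)
    also have "(\<Sum>j\<le>n. of_real (J j (Suc n)) * (e (Suc n) z * e j w - e j z * e (Suc n) w))
        = (\<Sum>j\<in>{n}. of_real (J j (Suc n)) * (e (Suc n) z * e j w - e j z * e (Suc n) w))"
      by (rule sum.mono_neutral_right) (auto simp: band)
    also have "(\<Sum>j\<le>n. \<Sum>k\<le>n. of_real (J j k) * (e k z * e j w - e j z * e k w)) = 0"
    proof -
      define S where "S = (\<Sum>j\<le>n. \<Sum>k\<le>n. of_real (J j k) * (e k z * e j w - e j z * e k w))"
      have "S = (\<Sum>k\<le>n. \<Sum>j\<le>n. of_real (J j k) * (e k z * e j w - e j z * e k w))"
        unfolding S_def by (rule sum.swap)
      also have "\<dots> = - S"
        unfolding S_def sum_negf[symmetric]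
        by (intro sum.cong refl) (subst sym, simp add: algebra_simps)
      finally show ?thesis unfolding S_def by simp
    qed
    finally show ?thesis by simp
  qed
  then show ?thesis using that unfolding e_def by blast
qed

text \<open>
  Let \<open>G(z, w)\<close> be the kernel sum and \<open>N = (z - w) G\<close>, which the Christoffel--Darboux formula gives in
  closed form. Differentiating \<open>N = (z - w) G\<close> in \<open>z\<close>, in \<open>w\<close> and in both yields
  \<open>(z - w)\<^sup>2 (G G\<^sub>z\<^sub>w - G\<^sub>z G\<^sub>w) = N N\<^sub>z\<^sub>w - N\<^sub>z N\<^sub>w - G\<^sup>2\<close>, which is \<open>\<partial>\<^sub>z \<partial>\<^sub>w log G = \<partial>\<^sub>z \<partial>\<^sub>w log N - \<partial>\<^sub>z \<partial>\<^sub>w log (z - w)\<close>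
  without denominators. The determinant \<open>N N\<^sub>z\<^sub>w - N\<^sub>z N\<^sub>w\<close> factors into the Wronskian of \<open>p\<^sub>n\<^sub>+\<^sub>1\<close> and \<open>p\<^sub>n\<close>
  at \<open>z\<close> times the same Wronskian at \<open>w\<close>.
\<close>

lemma christoffel_darboux_wronskian:
  assumes "orthogonal_on_real_line \<mu> p"
  obtains c :: complex where
    "\<And>z w. (z - w) * (\<Sum>j\<le>n. poly (cpoly (p j)) z * poly (cpoly (p j)) w) =
       c * (poly (cpoly (p (Suc n))) z * poly (cpoly (p n)) w
            - poly (cpoly (p n)) z * poly (cpoly (p (Suc n))) w)"
    "\<And>z w. (z - w)\<^sup>2 *
        ((\<Sum>j\<le>n. poly (cpoly (p j)) z * poly (cpoly (p j)) w) *
         (\<Sum>j\<le>n. poly (pderiv (cpoly (p j))) z * poly (pderiv (cpoly (p j))) w) -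
         (\<Sum>j\<le>n. poly (pderiv (cpoly (p j))) z * poly (cpoly (p j)) w) *
         (\<Sum>j\<le>n. poly (cpoly (p j)) z * poly (pderiv (cpoly (p j))) w)) =
      c\<^sup>2 * ((poly (pderiv (cpoly (p (Suc n)))) z * poly (cpoly (p n)) z
             - poly (pderiv (cpoly (p n))) z * poly (cpoly (p (Suc n))) z) *
            (poly (pderiv (cpoly (p (Suc n)))) w * poly (cpoly (p n)) w
             - poly (pderiv (cpoly (p n))) w * poly (cpoly (p (Suc n))) w))
       - (\<Sum>j\<le>n. poly (cpoly (p j)) z * poly (cpoly (p j)) w)\<^sup>2"
proof -
  define e where "e j z = poly (cpoly (p j)) z" for j z
  define d where "d j z = poly (pderiv (cpoly (p j))) z" for j z
  obtain c where cd: "\<And>z w. (z - w) * (\<Sum>j\<le>n. e j z * e j w) = c * (e (Suc n) z * e n w - e n z * e (Suc n) w)"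
    unfolding e_def by (rule christoffel_darboux[OF assms, of n]) blast
  define G where "G z w = (\<Sum>j\<le>n. e j z * e j w)" for z w
  define Gz where "Gz z w = (\<Sum>j\<le>n. d j z * e j w)" for z w
  define Gw where "Gw z w = (\<Sum>j\<le>n. e j z * d j w)" for z w
  define Gzw where "Gzw z w = (\<Sum>j\<le>n. d j z * d j w)" for z w
  have de [derivative_intros]: "(e j has_field_derivative d j z) (at z)" for j z
    unfolding e_def d_def by (rule poly_DERIV)
  have N: "(z - w) * G z w = c * (e (Suc n) z * e n w - e n z * e (Suc n) w)" for z w
    unfolding G_def by (rule cd)
  have Nz: "G z w + (z - w) * Gz z w = c * (d (Suc n) z * e n w - d n z * e (Suc n) w)" for z w
  proof (rule DERIV_unique)
    show "((\<lambda>z. (z - w) * G z w) has_field_derivative G z w + (z - w) * Gz z w) (at z)"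
      unfolding G_def Gz_def by (auto intro!: derivative_eq_intros)
    show "((\<lambda>z. (z - w) * G z w) has_field_derivative c * (d (Suc n) z * e n w - d n z * e (Suc n) w)) (at z)"
      unfolding N by (auto intro!: derivative_eq_intros)
  qed
  have Nw: "- G z w + (z - w) * Gw z w = c * (e (Suc n) z * d n w - e n z * d (Suc n) w)" for z w
  proof (rule DERIV_unique)
    show "((\<lambda>w. (z - w) * G z w) has_field_derivative - G z w + (z - w) * Gw z w) (at w)"
      unfolding G_def Gw_def by (auto intro!: derivative_eq_intros simp: mult.commute)
    show "((\<lambda>w. (z - w) * G z w) has_field_derivative c * (e (Suc n) z * d n w - e n z * d (Suc n) w)) (at w)"
      unfolding N by (auto intro!: derivative_eq_intros)
  qed
  have Nzw: "Gw z w - Gz z w + (z - w) * Gzw z w = c * (d (Suc n) z * d n w - d n z * d (Suc n) w)" for z w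
  proof (rule DERIV_unique)
    show "((\<lambda>w. G z w + (z - w) * Gz z w) has_field_derivative Gw z w - Gz z w + (z - w) * Gzw z w) (at w)"
      unfolding G_def Gw_def Gz_def Gzw_def by (auto intro!: derivative_eq_intros simp: mult.commute)
    show "((\<lambda>w. G z w + (z - w) * Gz z w) has_field_derivative c * (d (Suc n) z * d n w - d n z * d (Suc n) w)) (at w)"
      unfolding Nz by (auto intro!: derivative_eq_intros)
  qed
  have "(z - w)\<^sup>2 * (G z w * Gzw z w - Gz z w * Gw z w)
      = c\<^sup>2 * ((d (Suc n) z * e n z - d n z * e (Suc n) z) * (d (Suc n) w * e n w - d n w * e (Suc n) w))
        - (G z w)\<^sup>2" for z w
  proof -
    define g gz gw gzw t where "g = G z w" and "gz = Gz z w" and "gw = Gw z w" and "gzw = Gzw z w"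
      and "t = z - w"
    have "t\<^sup>2 * (g * gzw - gz * gw) + g\<^sup>2 = (t * g) * (gw - gz + t * gzw) - (g + t * gz) * (- g + t * gw)"
      by (simp add: power2_eq_square algebra_simps)
    also have "\<dots> = c * (e (Suc n) z * e n w - e n z * e (Suc n) w) * (c * (d (Suc n) z * d n w - d n z * d (Suc n) w))
        - c * (d (Suc n) z * e n w - d n z * e (Suc n) w) * (c * (e (Suc n) z * d n w - e n z * d (Suc n) w))"
      unfolding g_def gz_def gw_def gzw_def t_def N Nz Nw Nzw ..
    also have "\<dots> = c\<^sup>2 * ((d (Suc n) z * e n z - d n z * e (Suc n) z) * (d (Suc n) w * e n w - d n w * e (Suc n) w))"
      by (simp add: power2_eq_square algebra_simps)
    finally show ?thesis unfolding g_def gz_def gw_def gzw_def t_def by (simp add: algebra_simps)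
  qed
  with cd show ?thesis using that[of c] unfolding G_def Gz_def Gw_def Gzw_def e_def d_def by blast
qed

lemma K_diag: "K p n z z = of_real (\<Sum>j\<le>n. (cmod (poly (cpoly (p j)) z))\<^sup>2)"
  by (simp add: K_def complex_norm_square[symmetric])

text \<open>
  At \<open>w = cnj z\<close> the polarized identities become statements about the kernels: \<open>G(z, cnj z) = K\<^sub>n(z, z)\<close>,
  the two Wronskians are conjugate, and \<open>(z - w)\<^sup>2 = - 4 (Im z)\<^sup>2\<close>. The unknown constant \<open>c\<close> cancels because
  \<open>Im z \<cdot> K\<^sub>n(z, z) = c \<cdot> Im (p\<^sub>n\<^sub>+\<^sub>1(z) p\<^sub>n(cnj z))\<close>.
\<close>

lemma hP_eq_simplified:
  assumes orth: "orthogonal_on_real_line \<mu> p" and z: "Im z \<noteq> 0" and K: "K p n z z \<noteq> 0"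
  shows "Im (poly (cpoly (p (Suc n))) z * poly (cpoly (p n)) (cnj z)) \<noteq> 0"
    and "hP p n z = complex_of_real (simplified_hP p n z)"
proof -
  define e where "e j z = poly (cpoly (p j)) z" for j z
  define d where "d j z = poly (pderiv (cpoly (p j))) z" for j z
  define D where "D = Im (e (Suc n) z * e n (cnj z))"
  define W where "W = d (Suc n) z * e n z - d n z * e (Suc n) z"
  have ce: "cnj (e j u) = e j (cnj u)" and cdd: "cnj (d j u) = d j (cnj u)" for j u
    by (simp_all add: e_def d_def cnj_poly_cpoly cnj_poly_pderiv_cpoly)
  obtain c where
    cd: "\<And>z w. (z - w) * (\<Sum>j\<le>n. e j z * e j w) = c * (e (Suc n) z * e n w - e n z * e (Suc n) w)"
    and wr: "\<And>z w. (z - w)\<^sup>2 *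
        ((\<Sum>j\<le>n. e j z * e j w) * (\<Sum>j\<le>n. d j z * d j w) - (\<Sum>j\<le>n. d j z * e j w) * (\<Sum>j\<le>n. e j z * d j w)) =
      c\<^sup>2 * ((d (Suc n) z * e n z - d n z * e (Suc n) z) * (d (Suc n) w * e n w - d n w * e (Suc n) w))
       - (\<Sum>j\<le>n. e j z * e j w)\<^sup>2"
    unfolding e_def d_def by (rule christoffel_darboux_wronskian[OF orth, of n]) blast
  define k where "k = K p n z z"
  have k: "k = (\<Sum>j\<le>n. e j z * e j (cnj z))"
    by (simp add: k_def K_def e_def cnj_poly_cpoly)
  have k0: "k \<noteq> 0" using K k_def by simp
  have zz: "z - cnj z = 2 * \<i> * of_real (Im z)"
    by (simp add: complex_eq_iff)
  have "e (Suc n) z * e n (cnj z) - e n z * e (Suc n) (cnj z) = 2 * \<i> * of_real D"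
  proof -
    have "e n z * e (Suc n) (cnj z) = cnj (e (Suc n) z * e n (cnj z))"
      by (simp add: ce mult.commute)
    then show ?thesis by (simp add: complex_eq_iff D_def)
  qed
  with cd[of z "cnj z"] have kD: "of_real (Im z) * k = c * of_real D"
    unfolding zz k[symmetric] by simp
  with z k0 have D0: "D \<noteq> 0" and c0: "c \<noteq> 0" by auto
  then show "Im (poly (cpoly (p (Suc n))) z * poly (cpoly (p n)) (cnj z)) \<noteq> 0"
    by (simp add: D_def e_def)
  have K01: "K01 p n z z = (\<Sum>j\<le>n. e j z * d j (cnj z))"
    by (simp add: K01_def e_def d_def cnj_poly_pderiv_cpoly)
  have K01': "cnj (K01 p n z z) = (\<Sum>j\<le>n. d j z * e j (cnj z))"
    unfolding K01 cnj_sum by (rule sum.cong) (auto simp: ce cdd mult.commute)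
  have K11: "K11 p n z z = (\<Sum>j\<le>n. d j z * d j (cnj z))"
    by (simp add: K11_def d_def cnj_poly_pderiv_cpoly)
  define B where "B = K11 p n z z * k - complex_of_real ((cmod (K01 p n z z))\<^sup>2)"
  have B: "B = k * (\<Sum>j\<le>n. d j z * d j (cnj z)) - (\<Sum>j\<le>n. d j z * e j (cnj z)) * (\<Sum>j\<le>n. e j z * d j (cnj z))"
    unfolding B_def complex_norm_square K01' K01[symmetric] K11 by (simp add: mult.commute)
  have "d (Suc n) (cnj z) * e n (cnj z) - d n (cnj z) * e (Suc n) (cnj z) = cnj W"
    by (simp add: W_def ce cdd)
  with wr[of z "cnj z"] have "(z - cnj z)\<^sup>2 * B = c\<^sup>2 * (W * cnj W) - k\<^sup>2"
    unfolding B k[symmetric] W_def by simp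
  then have BB: "- 4 * (of_real (Im z))\<^sup>2 * B = c\<^sup>2 * of_real ((cmod W)\<^sup>2) - k\<^sup>2"
    unfolding zz complex_norm_square by (simp add: power2_eq_square algebra_simps)
  have k_eq: "k = c * of_real D / of_real (Im z)" using kD z by (simp add: field_simps)
  have "hP p n z = B / (of_real pi * k\<^sup>2)"
    by (simp add: hP_def B_def k_def)
  also have "\<dots> = (k\<^sup>2 - c\<^sup>2 * of_real ((cmod W)\<^sup>2)) / (4 * (of_real (Im z))\<^sup>2) / (of_real pi * k\<^sup>2)"
    using BB z by (simp add: field_simps)
  also have "\<dots> = 1 / (4 * of_real pi * (of_real (Im z))\<^sup>2) - of_real ((cmod W)\<^sup>2) / (4 * of_real pi * (of_real D)\<^sup>2)"
    unfolding k_eq using z D0 c0 by (simp add: field_simps power2_eq_square)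
  also have "\<dots> = complex_of_real (simplified_hP p n z)"
    by (simp add: simplified_hP_def W_def D_def e_def d_def)
  finally show "hP p n z = complex_of_real (simplified_hP p n z)" .
qed

text \<open>
  As \<open>K\<^sub>n\<close> has no zero on the diagonal, \<open>hP\<close> is continuous on the whole plane, hence it is the continuous
  extension of its simplified form.
\<close>

lemma tendsto_simplified_hP:
  assumes orth: "orthogonal_on_real_line \<mu> p" and K: "\<And>z. K p n z z \<noteq> 0"
  shows "((\<lambda>w. complex_of_real (simplified_hP p n w)) \<longlongrightarrow> hP p n z) (at z within {w. Im w \<noteq> 0})"
proof -
  have "isCont (hP p n) z"
    unfolding hP_def[abs_def] K_def K01_def K11_def
    using K[of z] by (intro continuous_intros) (auto simp: K_def)
  then have "(hP p n \<longlongrightarrow> hP p n z) (at z within {w. Im w \<noteq> 0})"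
    by (meson continuous_at_imp_continuous_at_within continuous_within)
  moreover have "\<forall>\<^sub>F w in at z within {w. Im w \<noteq> 0}. hP p n w = complex_of_real (simplified_hP p n w)"
    using hP_eq_simplified(2)[OF orth _ K] by (auto simp: eventually_at_filter)
  ultimately show ?thesis by (rule Lim_transform_eventually)
qed

section \<open>Linear changes of variables for Lebesgue measure\<close>

lemma nn_integral_lborel_linear_2d_aux:
  fixes f :: "'k::{euclidean_space, real_normed_field} \<times> 'k \<Rightarrow> ennreal" and m :: "'k \<Rightarrow> ennreal"
  assumes affine: "\<And>(g :: 'k \<Rightarrow> ennreal) c t. g \<in> borel_measurable borel \<Longrightarrow> c \<noteq> 0 \<Longrightarrow>
      (\<integral>\<^sup>+x. g x \<partial>lborel) = m c * (\<integral>\<^sup>+x. g (t + c * x) \<partial>lborel)"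
    and mult: "\<And>x y. m (x * y) = m x * m y"
    and f [measurable]: "f \<in> borel_measurable (borel \<Otimes>\<^sub>M borel)"
    and a: "a \<noteq> 0" and det: "a * d - b * c \<noteq> 0"
  shows "(\<integral>\<^sup>+x. \<integral>\<^sup>+y. f (x, y) \<partial>lborel \<partial>lborel) =
    m (a * d - b * c) * (\<integral>\<^sup>+x. \<integral>\<^sup>+y. f (a * x + b * y, c * x + d * y) \<partial>lborel \<partial>lborel)"
proof -
  define e where "e = (a * d - b * c) / a"
  have e: "e \<noteq> 0" "a * d - b * c = e * a" using a det by (auto simp: e_def)
  have swap: "(\<integral>\<^sup>+x. \<integral>\<^sup>+y. g (x, y) \<partial>lborel \<partial>lborel) = (\<integral>\<^sup>+y. \<integral>\<^sup>+x. g (x, y) \<partial>lborel \<partial>lborel)"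
    if "g \<in> borel_measurable (borel \<Otimes>\<^sub>M borel)" for g :: "'k \<times> 'k \<Rightarrow> ennreal"
    using lborel_pair.Fubini[of g] that by (simp cong: measurable_cong_sets)
  have "(\<integral>\<^sup>+x. \<integral>\<^sup>+y. f (x, y) \<partial>lborel \<partial>lborel)
      = (\<integral>\<^sup>+u. m e * (\<integral>\<^sup>+y. f (u, c * u / a + e * y) \<partial>lborel) \<partial>lborel)"
    by (intro nn_integral_cong affine e) measurable
  also have "\<dots> = m e * (\<integral>\<^sup>+u. \<integral>\<^sup>+y. f (u, c * u / a + e * y) \<partial>lborel \<partial>lborel)"
    by (rule nn_integral_cmult) measurable
  also have "\<dots> = m e * (\<integral>\<^sup>+y. \<integral>\<^sup>+u. f (u, c * u / a + e * y) \<partial>lborel \<partial>lborel)"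
    using swap[of "\<lambda>(u, y). f (u, c * u / a + e * y)"] by simp
  also have "\<dots> = m e * (\<integral>\<^sup>+y. m a * (\<integral>\<^sup>+x. f (b * y + a * x, c * (b * y + a * x) / a + e * y) \<partial>lborel) \<partial>lborel)"
    by (intro arg_cong[of _ _ "(*) (m e)"] nn_integral_cong affine a) measurable
  also have "\<dots> = m e * (m a * (\<integral>\<^sup>+y. \<integral>\<^sup>+x. f (b * y + a * x, c * (b * y + a * x) / a + e * y) \<partial>lborel \<partial>lborel))"
    by (subst nn_integral_cmult) measurable
  also have "(\<lambda>y x. f (b * y + a * x, c * (b * y + a * x) / a + e * y)) = (\<lambda>y x. f (a * x + b * y, c * x + d * y))"
    using a by (intro ext arg_cong[of _ _ f]) (auto simp: e_def field_simps)
  also have "(\<integral>\<^sup>+y. \<integral>\<^sup>+x. f (a * x + b * y, c * x + d * y) \<partial>lborel \<partial>lborel)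
      = (\<integral>\<^sup>+x. \<integral>\<^sup>+y. f (a * x + b * y, c * x + d * y) \<partial>lborel \<partial>lborel)"
    using swap[of "\<lambda>(x, y). f (a * x + b * y, c * x + d * y)"] by simp
  finally show ?thesis
    unfolding e(2) mult by (simp add: mult.assoc)
qed

text \<open>
  A linear map of the plane over \<open>\<real>\<close> or \<open>\<complex>\<close> is a composition of shears and scalings in one
  variable, so Fubini reduces its effect on Lebesgue measure to the one-variable modulus \<open>m\<close>. It is
  used over \<open>\<real>\<close> to find the modulus of \<open>\<complex>\<close>, and then over \<open>\<complex>\<close>.
\<close>

lemma nn_integral_lborel_linear_2d:
  fixes f :: "'k::{euclidean_space, real_normed_field} \<times> 'k \<Rightarrow> ennreal" and m :: "'k \<Rightarrow> ennreal"
  assumes affine: "\<And>(g :: 'k \<Rightarrow> ennreal) c t. g \<in> borel_measurable borel \<Longrightarrow> c \<noteq> 0 \<Longrightarrow>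
      (\<integral>\<^sup>+x. g x \<partial>lborel) = m c * (\<integral>\<^sup>+x. g (t + c * x) \<partial>lborel)"
    and mult: "\<And>x y. m (x * y) = m x * m y" and minus: "\<And>x. m (- x) = m x"
    and f [measurable]: "f \<in> borel_measurable (borel \<Otimes>\<^sub>M borel)"
    and det: "a * d - b * c \<noteq> 0"
  shows "(\<integral>\<^sup>+x. \<integral>\<^sup>+y. f (x, y) \<partial>lborel \<partial>lborel) =
    m (a * d - b * c) * (\<integral>\<^sup>+x. \<integral>\<^sup>+y. f (a * x + b * y, c * x + d * y) \<partial>lborel \<partial>lborel)"
proof (cases "a = 0")
  case False
  then show ?thesis by (intro nn_integral_lborel_linear_2d_aux assms)
next
  case True
  have "(\<integral>\<^sup>+x. \<integral>\<^sup>+y. f (x, y) \<partial>lborel \<partial>lborel) =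
    m (b * c - a * d) * (\<integral>\<^sup>+y. \<integral>\<^sup>+x. f (b * y + a * x, d * y + c * x) \<partial>lborel \<partial>lborel)"
    using True det by (intro nn_integral_lborel_linear_2d_aux affine mult f) auto
  also have "m (b * c - a * d) = m (a * d - b * c)" using minus[of "a * d - b * c"] by simp
  also have "(\<integral>\<^sup>+y. \<integral>\<^sup>+x. f (b * y + a * x, d * y + c * x) \<partial>lborel \<partial>lborel)
      = (\<integral>\<^sup>+x. \<integral>\<^sup>+y. f (b * y + a * x, d * y + c * x) \<partial>lborel \<partial>lborel)"
    using lborel_pair.Fubini[of "\<lambda>(x, y). f (b * y + a * x, d * y + c * x)"] by simp
  finally show ?thesis by (simp add: add.commute)
qed

lemma measurable_Complex [measurable (raw)]:
  "f \<in> borel_measurable M \<Longrightarrow> g \<in> borel_measurable M \<Longrightarrow> (\<lambda>x. Complex (f x) (g x)) \<in> borel_measurable M"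
  by (simp add: borel_measurable_complex_iff)

lemma lborel_complex:
  "(lborel :: complex measure) = distr (lborel \<Otimes>\<^sub>M lborel) borel (\<lambda>(x, y). Complex x y)"
proof (rule lborel_eqI)
  fix l u :: complex assume le: "\<And>b. b \<in> Basis \<Longrightarrow> l \<bullet> b \<le> u \<bullet> b"
  have le: "Re l \<le> Re u" "Im l \<le> Im u" using le[of 1] le[of \<i>] by (auto simp: Basis_complex_def)
  have "(\<lambda>(x, y). Complex x y) -` box l u = {Re l<..<Re u} \<times> {Im l<..<Im u}"
    by (auto simp: in_box_complex_iff)
  then have "emeasure (distr (lborel \<Otimes>\<^sub>M lborel) borel (\<lambda>(x, y). Complex x y)) (box l u)
      = emeasure (lborel \<Otimes>\<^sub>M lborel) ({Re l<..<Re u} \<times> {Im l<..<Im u})"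
    by (subst emeasure_distr) (auto simp: space_pair_measure)
  also have "\<dots> = ennreal (Re u - Re l) * ennreal (Im u - Im l)"
    using le by (subst lborel.emeasure_pair_measure_Times) auto
  also have "\<dots> = ennreal (\<Prod>b\<in>Basis. (u - l) \<bullet> b)"
    using le by (simp add: Basis_complex_def ennreal_mult)
  finally show "emeasure (distr (lborel \<Otimes>\<^sub>M lborel) borel (\<lambda>(x, y). Complex x y)) (box l u)
      = ennreal (\<Prod>b\<in>Basis. (u - l) \<bullet> b)" .
qed simp

lemma nn_integral_lborel_complex:
  assumes [measurable]: "f \<in> borel_measurable borel"
  shows "(\<integral>\<^sup>+z. f z \<partial>lborel) = (\<integral>\<^sup>+x. \<integral>\<^sup>+y. f (Complex x y) \<partial>lborel \<partial>lborel)"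
  by (subst lborel_complex)
    (simp add: nn_integral_distr lborel.nn_integral_fst[symmetric] split_beta')

text \<open>
  Over \<open>\<real>\<close>, multiplication by \<open>c\<close> has the matrix \<open>(Re c, - Im c; Im c, Re c)\<close> of determinant \<open>\<bar>c\<bar>\<^sup>2\<close>.
\<close>

lemma nn_integral_complex_affine:
  fixes f :: "complex \<Rightarrow> ennreal"
  assumes [measurable]: "f \<in> borel_measurable borel" and c: "c \<noteq> 0"
  shows "(\<integral>\<^sup>+z. f z \<partial>lborel) = ennreal ((cmod c)\<^sup>2) * (\<integral>\<^sup>+z. f (t + c * z) \<partial>lborel)"
proof -
  have c2: "(cmod c)\<^sup>2 = \<bar>Re c * Re c - (- Im c) * Im c\<bar>" "Re c * Re c - (- Im c) * Im c \<noteq> 0"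
    using c by (simp only: cmod_power2, simp add: power2_eq_square)
      (use c in \<open>auto simp: complex_eq_iff sum_squares_eq_zero_iff\<close>)
  have "(\<integral>\<^sup>+z. f z \<partial>lborel) = (\<integral>\<^sup>+z. f (t + z) \<partial>lborel)"
    by (subst (1) lborel_distr_plus[of t, symmetric]) (simp add: nn_integral_distr del: lborel_distr_plus)
  also have "\<dots> = (\<integral>\<^sup>+x. \<integral>\<^sup>+y. (\<lambda>(x, y). f (t + Complex x y)) (x, y) \<partial>lborel \<partial>lborel)"
    by (subst nn_integral_lborel_complex) simp_all
  also have "\<dots> = ennreal ((cmod c)\<^sup>2) * (\<integral>\<^sup>+x. \<integral>\<^sup>+y. (\<lambda>(x, y). f (t + Complex x y))
      (Re c * x + (- Im c) * y, Im c * x + Re c * y) \<partial>lborel \<partial>lborel)"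
    unfolding c2(1) using c2(2)
    by (intro nn_integral_lborel_linear_2d)
      (auto simp: nn_integral_real_affine[symmetric] abs_mult ennreal_mult)
  also have "(\<integral>\<^sup>+x. \<integral>\<^sup>+y. (\<lambda>(x, y). f (t + Complex x y))
      (Re c * x + (- Im c) * y, Im c * x + Re c * y) \<partial>lborel \<partial>lborel)
      = (\<integral>\<^sup>+x. \<integral>\<^sup>+y. f (t + c * Complex x y) \<partial>lborel \<partial>lborel)"
    by (intro nn_integral_cong) (auto simp: complex_eq_iff intro!: arg_cong[of _ _ f])
  also have "\<dots> = (\<integral>\<^sup>+z. f (t + c * z) \<partial>lborel)"
    by (subst nn_integral_lborel_complex) simp_all
  finally show ?thesis .
qed

section \<open>The standard complex Gaussian measure\<close>

text \<open>
  The normalization is that of \<open>\<alpha> + \<i> \<beta>\<close> with \<open>\<alpha>\<close>, \<open>\<beta>\<close> independent standard normal, so \<open>E \<bar>z\<bar>\<^sup>2 = 2\<close>.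
\<close>

definition cgauss :: "complex measure" where
  "cgauss = density lborel (\<lambda>z. ennreal (exp (- (cmod z)\<^sup>2 / 2) / (2 * pi)))"

abbreviation std_gauss :: "real measure" where
  "std_gauss \<equiv> density lborel (\<lambda>x. ennreal (std_normal_density x))"

lemma sets_cgauss [measurable_cong, simp]: "sets cgauss = sets borel"
  by (simp add: cgauss_def)

lemma space_cgauss [simp]: "space cgauss = UNIV"
  by (simp add: cgauss_def)

lemma prob_space_std_gauss: "prob_space std_gauss"
  by (rule prob_space_normal_density) simp

lemma cgauss_eq_distr: "cgauss = distr (std_gauss \<Otimes>\<^sub>M std_gauss) borel (\<lambda>(x, y). Complex x y)"
proof -
  interpret N: prob_space std_gauss by (rule prob_space_std_gauss)
  have dens: "std_normal_density x * std_normal_density y = exp (- (x\<^sup>2 + y\<^sup>2) / 2) / (2 * pi)" for x y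
  proof -
    have "exp (- (x\<^sup>2 + y\<^sup>2) / 2) = exp (- x\<^sup>2 / 2) * exp (- y\<^sup>2 / 2)"
      by (simp add: exp_add[symmetric] add_divide_distrib)
    then show ?thesis by (simp add: std_normal_density_def real_sqrt_mult field_simps)
  qed
  have "cgauss = distr (density (lborel \<Otimes>\<^sub>M lborel) (\<lambda>w. ennreal
      (exp (- (cmod (case w of (x, y) \<Rightarrow> Complex x y))\<^sup>2 / 2) / (2 * pi)))) borel (\<lambda>(x, y). Complex x y)"
    unfolding cgauss_def by (subst lborel_complex) (subst density_distr, auto)
  also have "density (lborel \<Otimes>\<^sub>M lborel) (\<lambda>w. ennreal
      (exp (- (cmod (case w of (x, y) \<Rightarrow> Complex x y))\<^sup>2 / 2) / (2 * pi)))
     = density (lborel \<Otimes>\<^sub>M lborel) (\<lambda>(x, y). ennreal (std_normal_density x) * ennreal (std_normal_density y))"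
    by (rule arg_cong[of _ _ "density _"])
      (auto simp: fun_eq_iff ennreal_mult'[symmetric] cmod_power2 dens)
  also have "\<dots> = std_gauss \<Otimes>\<^sub>M std_gauss"
    by (subst pair_measure_density)
      (auto intro: N.sigma_finite_measure_axioms lborel.sigma_finite_measure_axioms)
  finally show ?thesis .
qed

lemma prob_space_cgauss: "prob_space cgauss"
proof -
  interpret N: prob_space std_gauss by (rule prob_space_std_gauss)
  interpret NN: pair_prob_space std_gauss std_gauss ..
  show ?thesis unfolding cgauss_eq_distr by (rule NN.prob_space_distr) simp
qed

lemma nn_integral_cgauss:
  "f \<in> borel_measurable borel \<Longrightarrow>
    (\<integral>\<^sup>+z. f z \<partial>cgauss) = (\<integral>\<^sup>+z. ennreal (exp (- (cmod z)\<^sup>2 / 2) / (2 * pi)) * f z \<partial>lborel)"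
  unfolding cgauss_def by (subst nn_integral_density) auto

text \<open>
  The density of \<open>cgauss \<Otimes>\<^sub>M cgauss\<close> depends only on the Euclidean norm of \<open>\<complex>\<^sup>2\<close>, so it is invariant under
  the unitary map \<open>(\<xi>, \<zeta>) \<mapsto> (a \<xi> + b \<zeta>, - cnj b \<xi> + cnj a \<zeta>)\<close>.
\<close>

lemma cgauss_unitary_invariant:
  assumes ab: "(cmod a)\<^sup>2 + (cmod b)\<^sup>2 = 1"
  shows "distr (cgauss \<Otimes>\<^sub>M cgauss) (borel \<Otimes>\<^sub>M borel) (\<lambda>(\<xi>, \<zeta>). (a * \<xi> + b * \<zeta>, - cnj b * \<xi> + cnj a * \<zeta>))
     = cgauss \<Otimes>\<^sub>M cgauss" (is "distr ?G _ ?T = _")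
proof -
  interpret C: prob_space cgauss by (rule prob_space_cgauss)
  define \<rho> where "\<rho> z = ennreal (exp (- (cmod z)\<^sup>2 / 2) / (2 * pi))" for z
  have [measurable]: "\<rho> \<in> borel_measurable borel" unfolding \<rho>_def by measurable
  have int: "(\<integral>\<^sup>+w. f w \<partial>?G) = (\<integral>\<^sup>+x. \<integral>\<^sup>+y. \<rho> x * \<rho> y * f (x, y) \<partial>lborel \<partial>lborel)"
    if [measurable]: "f \<in> borel_measurable (borel \<Otimes>\<^sub>M borel)" for f
  proof -
    have "(\<integral>\<^sup>+w. f w \<partial>?G) = (\<integral>\<^sup>+x. \<integral>\<^sup>+y. f (x, y) \<partial>cgauss \<partial>cgauss)"
      by (subst C.nn_integral_fst) simp_all
    also have "\<dots> = (\<integral>\<^sup>+x. \<rho> x * (\<integral>\<^sup>+y. \<rho> y * f (x, y) \<partial>lborel) \<partial>lborel)"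
      unfolding \<rho>_def by (simp add: nn_integral_cgauss)
    finally show ?thesis by (simp add: nn_integral_cmult mult.assoc)
  qed
  have \<rho>2: "\<rho> x * \<rho> y = ennreal (exp (- ((cmod x)\<^sup>2 + (cmod y)\<^sup>2) / 2) / (4 * pi\<^sup>2))" for x y
    by (simp add: \<rho>_def ennreal_mult'[symmetric] exp_add[symmetric] power2_eq_square field_simps)
  have norm: "(cmod (a * x + b * y))\<^sup>2 + (cmod (- cnj b * x + cnj a * y))\<^sup>2 = (cmod x)\<^sup>2 + (cmod y)\<^sup>2" for x y
  proof -
    have "complex_of_real ((cmod (a * x + b * y))\<^sup>2 + (cmod (- cnj b * x + cnj a * y))\<^sup>2)
      = of_real ((cmod a)\<^sup>2 + (cmod b)\<^sup>2) * of_real ((cmod x)\<^sup>2 + (cmod y)\<^sup>2)"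
      unfolding of_real_add complex_norm_square by (simp add: algebra_simps)
    then show ?thesis unfolding ab by (metis of_real_1 mult_1 of_real_eq_iff)
  qed
  have norm': "- (cmod (a * x + b * y))\<^sup>2 - (cmod (cnj a * y - cnj b * x))\<^sup>2 = - (cmod x)\<^sup>2 - (cmod y)\<^sup>2" for x y
    using norm[of x y] by simp
  have det: "a * cnj a - b * (- cnj b) = 1"
    using ab unfolding of_real_eq_iff[symmetric, where 'a=complex] of_real_add complex_norm_square by simp
  show ?thesis
  proof (rule measure_eqI)
    fix A assume "A \<in> sets (distr ?G (borel \<Otimes>\<^sub>M borel) ?T)"
    then have [measurable]: "A \<in> sets (borel \<Otimes>\<^sub>M borel)" by simp
    have "emeasure (distr ?G (borel \<Otimes>\<^sub>M borel) ?T) A = (\<integral>\<^sup>+w. indicator A w \<partial>distr ?G (borel \<Otimes>\<^sub>M borel) ?T)"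
      by simp
    also have "\<dots> = (\<integral>\<^sup>+w. indicator A (?T w) \<partial>?G)"
      by (subst nn_integral_distr) auto
    also have "\<dots> = (\<integral>\<^sup>+x. \<integral>\<^sup>+y. \<rho> x * \<rho> y * indicator A (?T (x, y)) \<partial>lborel \<partial>lborel)"
      by (rule int) measurable
    also have "\<dots> = ennreal ((cmod (a * cnj a - b * (- cnj b)))\<^sup>2) * (\<integral>\<^sup>+x. \<integral>\<^sup>+y.
        (\<lambda>(u, v). \<rho> u * \<rho> v * indicator A (u, v)) (a * x + b * y, - cnj b * x + cnj a * y) \<partial>lborel \<partial>lborel)"
      unfolding det by (simp add: \<rho>2 norm')
    also have "\<dots> = (\<integral>\<^sup>+x. \<integral>\<^sup>+y. (\<lambda>(u, v). \<rho> u * \<rho> v * indicator A (u, v)) (x, y) \<partial>lborel \<partial>lborel)"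
      by (rule nn_integral_lborel_linear_2d[symmetric])
        (auto simp: nn_integral_complex_affine[symmetric] norm_mult power_mult_distrib ennreal_mult det[simplified])
    also have "\<dots> = emeasure ?G A"
      using int[of "indicator A"] by simp
    finally show "emeasure (distr ?G (borel \<Otimes>\<^sub>M borel) ?T) A = emeasure (cgauss \<Otimes>\<^sub>M cgauss) A" .
  qed (simp add: sets_pair_measure_cong[OF sets_cgauss sets_cgauss])
qed

lemma integrable_cgauss_times:
  fixes f g :: "complex \<Rightarrow> complex"
  assumes f: "integrable cgauss f" and g: "integrable cgauss g"
  shows "integrable (cgauss \<Otimes>\<^sub>M cgauss) (\<lambda>(u, v). f u * g v)"
    and "(\<integral>(u, v). f u * g v \<partial>(cgauss \<Otimes>\<^sub>M cgauss)) = (\<integral>u. f u \<partial>cgauss) * (\<integral>v. g v \<partial>cgauss)"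
proof -
  interpret C: prob_space cgauss by (rule prob_space_cgauss)
  interpret CC: pair_prob_space cgauss cgauss ..
  note [measurable] = borel_measurable_integrable[OF f] borel_measurable_integrable[OF g]
  show int: "integrable (cgauss \<Otimes>\<^sub>M cgauss) (\<lambda>(u, v). f u * g v)"
  proof (rule CC.Fubini_integrable)
    show "integrable cgauss (\<lambda>x. \<integral>y. norm (case (x, y) of (u, v) \<Rightarrow> f u * g v) \<partial>cgauss)"
      using f by (simp add: norm_mult)
    show "AE x in cgauss. integrable cgauss (\<lambda>y. case (x, y) of (u, v) \<Rightarrow> f u * g v)"
      using g by simp
  qed measurable
  show "(\<integral>(u, v). f u * g v \<partial>(cgauss \<Otimes>\<^sub>M cgauss)) = (\<integral>u. f u \<partial>cgauss) * (\<integral>v. g v \<partial>cgauss)"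
    by (subst CC.integral_fst[symmetric]) (use int in simp_all)
qed

lemma nn_integral_inverse_sqrt_std_gauss_finite:
  "(\<integral>\<^sup>+x. inverse (ennreal (sqrt \<bar>x\<bar>)) \<partial>std_gauss) < \<infinity>"
proof -
  define g where "g x = inverse (ennreal (sqrt \<bar>x\<bar>))" for x
  have [measurable]: "g \<in> borel_measurable borel" unfolding g_def by measurable
  have pos: "(\<integral>\<^sup>+x. indicator {0..1} x * g x \<partial>lborel) = ennreal 2"
  proof -
    have "(\<integral>\<^sup>+x. indicator {0..1} x * g x \<partial>lborel) = (\<integral>\<^sup>+x. ennreal (indicator {0..1} x * x powr (-1/2)) \<partial>lborel)"
    proof (rule nn_integral_cong_AE)
      show "AE x in lborel. indicator {0..1} x * g x = ennreal (indicator {0..1} x * x powr (-1/2))"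
        using AE_lborel_singleton[of 0]
        by eventually_elim
          (auto simp: g_def indicator_def inverse_ennreal powr_minus powr_half_sqrt)
    qed
    also have "\<dots> = ennreal 2"
    proof (rule nn_integral_has_integral_lebesgue)
      show "((\<lambda>x::real. x powr (-1/2)) has_integral 2) {0..1}"
        using has_integral_powr_from_0[of "-1/2" 1] by simp
    qed auto
    finally show ?thesis .
  qed
  have neg: "(\<integral>\<^sup>+x. indicator {-1..0} x * g x \<partial>lborel) = ennreal 2"
  proof -
    have "(\<integral>\<^sup>+x. indicator {-1..0} x * g x \<partial>lborel) = ennreal \<bar>-1\<bar> * (\<integral>\<^sup>+x. indicator {-1..0} (0 + -1 * x) * g (0 + -1 * x) \<partial>lborel)"
      by (rule nn_integral_real_affine) auto
    also have "\<dots> = (\<integral>\<^sup>+x. indicator {0..1} x * g x \<partial>lborel)"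
      by (simp, intro nn_integral_cong) (auto simp: g_def indicator_def)
    finally show ?thesis using pos by simp
  qed
  have le: "ennreal (std_normal_density x) * g x \<le>
      (indicator {0..1} x * g x + indicator {-1..0} x * g x) + ennreal (std_normal_density x)" for x
  proof (cases "\<bar>x\<bar> \<le> 1")
    case True
    have "std_normal_density x \<le> 1 * 1"
      unfolding std_normal_density_def using pi_ge_two by (intro mult_mono) auto
    then have "ennreal (std_normal_density x) \<le> 1" by simp
    then have "ennreal (std_normal_density x) * g x \<le> 1 * g x" by (intro mult_right_mono) auto
    moreover have "1 * g x \<le> (indicator {0..1} x * g x + indicator {-1..0} x * g x)"
      using True by (auto simp: indicator_def)
    ultimately show ?thesis by (meson add_increasing2 order_trans zero_le)
  next
    case False
    then have "g x = ennreal (inverse (sqrt \<bar>x\<bar>))" by (simp add: g_def inverse_ennreal)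
    also have "\<dots> \<le> ennreal 1" using False by (intro ennreal_leI) (simp add: field_simps)
    finally have "ennreal (std_normal_density x) * g x \<le> ennreal (std_normal_density x) * 1"
      by (intro mult_left_mono) auto
    then show ?thesis by (metis add_increasing mult.right_neutral zero_le)
  qed
  have "(\<integral>\<^sup>+x. g x \<partial>std_gauss) = (\<integral>\<^sup>+x. ennreal (std_normal_density x) * g x \<partial>lborel)"
    by (rule nn_integral_density) auto
  also have "\<dots> \<le> (\<integral>\<^sup>+x. (indicator {0..1} x * g x + indicator {-1..0} x * g x) + ennreal (std_normal_density x) \<partial>lborel)"
    by (intro nn_integral_mono le)
  also have "\<dots> = ennreal 2 + ennreal 2 + emeasure std_gauss (space std_gauss)"
    by (simp add: nn_integral_add pos neg emeasure_density)
  also have "\<dots> < \<infinity>"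
    using prob_space.emeasure_space_1[OF prob_space_std_gauss] by (simp add: ennreal_add_less_top)
  finally show ?thesis unfolding g_def .
qed

text \<open>
  \<open>1 / \<bar>z\<bar>\<close> is integrable in the plane. Since \<open>\<bar>x + \<i> y\<bar>\<^sup>2 \<ge> \<bar>x\<bar> \<bar>y\<bar>\<close>, the product of two
  one-variable integrals bounds it, which avoids polar coordinates.
\<close>

lemma nn_integral_inverse_norm_cgauss_finite:
  "(\<integral>\<^sup>+z. inverse (ennreal (cmod z)) \<partial>cgauss) < \<infinity>"
proof -
  interpret N: prob_space std_gauss by (rule prob_space_std_gauss)
  define g where "g x = inverse (ennreal (sqrt \<bar>x\<bar>))" for x
  have [measurable]: "g \<in> borel_measurable borel" unfolding g_def by measurable
  have gpos: "g x \<noteq> 0" for x by (simp add: g_def)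
  have le: "inverse (ennreal (cmod (Complex x y))) \<le> g x * g y" for x y
  proof (cases "x = 0 \<or> y = 0")
    case True
    then have "g x * g y = \<infinity>" using gpos
      by (auto simp: g_def ennreal_mult_eq_top_iff)
    then show ?thesis by simp
  next
    case False
    have "sqrt (\<bar>x\<bar> * \<bar>y\<bar>) \<le> cmod (Complex x y)"
    proof -
      have "0 \<le> (\<bar>x\<bar> - \<bar>y\<bar>)\<^sup>2 + \<bar>x\<bar> * \<bar>y\<bar>" by simp
      then have "\<bar>x\<bar> * \<bar>y\<bar> \<le> x\<^sup>2 + y\<^sup>2" by (simp add: power2_diff)
      then show ?thesis by (simp add: complex_norm)
    qed
    moreover have "g x * g y = ennreal (inverse (sqrt (\<bar>x\<bar> * \<bar>y\<bar>)))"
      using False by (simp add: g_def inverse_ennreal ennreal_mult'[symmetric] real_sqrt_mult)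
    moreover have "inverse (ennreal (cmod (Complex x y))) = ennreal (inverse (cmod (Complex x y)))"
      using False by (intro inverse_ennreal) (auto simp: complex_eq_iff)
    ultimately show ?thesis
      using False by (auto intro!: ennreal_leI le_imp_inverse_le)
  qed
  have "(\<integral>\<^sup>+z. inverse (ennreal (cmod z)) \<partial>cgauss)
      = (\<integral>\<^sup>+w. inverse (ennreal (cmod (case w of (x, y) \<Rightarrow> Complex x y))) \<partial>(std_gauss \<Otimes>\<^sub>M std_gauss))"
    unfolding cgauss_eq_distr by (rule nn_integral_distr) measurable
  also have "\<dots> \<le> (\<integral>\<^sup>+(x, y). g x * g y \<partial>(std_gauss \<Otimes>\<^sub>M std_gauss))"
    by (intro nn_integral_mono) (auto intro: le)
  also have "\<dots> = (\<integral>\<^sup>+x. \<integral>\<^sup>+y. g x * g y \<partial>std_gauss \<partial>std_gauss)"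
    by (subst N.nn_integral_fst[symmetric]) simp_all
  also have "\<dots> = (\<integral>\<^sup>+x. g x \<partial>std_gauss) * (\<integral>\<^sup>+y. g y \<partial>std_gauss)"
    by (simp add: nn_integral_cmult nn_integral_multc)
  also have "\<dots> < \<infinity>"
    using nn_integral_inverse_sqrt_std_gauss_finite unfolding g_def[symmetric]
    by (simp add: ennreal_mult_less_top)
  finally show ?thesis .
qed

lemma integrable_cgauss_inverse: "integrable cgauss (\<lambda>z. inverse z)"
proof (rule integrableI_bounded)
  have "(\<integral>\<^sup>+z. ennreal (norm (inverse z)) \<partial>cgauss) \<le> (\<integral>\<^sup>+z. inverse (ennreal (cmod z)) \<partial>cgauss)"
  proof (rule nn_integral_mono)
    fix z :: complex
    show "ennreal (norm (inverse z)) \<le> inverse (ennreal (cmod z))"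
      by (cases "z = 0") (auto simp: inverse_ennreal norm_inverse)
  qed
  then show "(\<integral>\<^sup>+z. ennreal (norm (inverse z)) \<partial>cgauss) < \<infinity>"
    using nn_integral_inverse_norm_cgauss_finite by (rule le_less_trans)
qed simp

lemma integrable_cgauss_ident: "integrable cgauss (\<lambda>z. z)"
proof -
  interpret N: prob_space std_gauss by (rule prob_space_std_gauss)
  interpret NN: pair_prob_space std_gauss std_gauss ..
  have mom: "(\<integral>\<^sup>+x. ennreal \<bar>x\<bar> \<partial>std_gauss) < \<infinity>"
  proof -
    have "(\<integral>\<^sup>+x. ennreal \<bar>x\<bar> \<partial>std_gauss) = (\<integral>\<^sup>+x. ennreal (norm (std_normal_density x * \<bar>x\<bar> ^ 1)) \<partial>lborel)"
      by (subst nn_integral_density) (auto simp: ennreal_mult'[symmetric] abs_mult)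
    also have "\<dots> < \<infinity>"
      using integrable_std_normal_moment_abs[of 1] unfolding integrable_iff_bounded by blast
    finally show ?thesis .
  qed
  have "(\<integral>\<^sup>+z. ennreal (norm z) \<partial>cgauss)
      = (\<integral>\<^sup>+w. ennreal (norm (case w of (x, y) \<Rightarrow> Complex x y)) \<partial>(std_gauss \<Otimes>\<^sub>M std_gauss))"
    unfolding cgauss_eq_distr by (rule nn_integral_distr) measurable
  also have "\<dots> \<le> (\<integral>\<^sup>+(x, y). ennreal \<bar>x\<bar> + ennreal \<bar>y\<bar> \<partial>(std_gauss \<Otimes>\<^sub>M std_gauss))"
    by (intro nn_integral_mono)
      (auto simp: ennreal_plus[symmetric] simp del: ennreal_plus intro!: ennreal_leI
        order_trans[OF cmod_le])
  also have "\<dots> = (\<integral>\<^sup>+x. \<integral>\<^sup>+y. ennreal \<bar>x\<bar> + ennreal \<bar>y\<bar> \<partial>std_gauss \<partial>std_gauss)"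
    by (subst N.nn_integral_fst[symmetric]) simp_all
  also have "\<dots> = (\<integral>\<^sup>+x. ennreal \<bar>x\<bar> \<partial>std_gauss) + (\<integral>\<^sup>+x. ennreal \<bar>x\<bar> \<partial>std_gauss)"
    using N.emeasure_space_1 by (simp add: nn_integral_add)
  also have "\<dots> < \<infinity>" using mom by simp
  finally show ?thesis by (intro integrableI_bounded) simp_all
qed

lemma integral_cgauss_ident: "(\<integral>z. z \<partial>cgauss) = 0"
proof -
  have "distr cgauss borel uminus = cgauss"
  proof (rule measure_eqI)
    fix A assume "A \<in> sets (distr cgauss borel (uminus :: complex \<Rightarrow> complex))"
    then have [measurable]: "A \<in> sets borel" by simp
    define \<rho> where "\<rho> z = ennreal (exp (- (cmod z)\<^sup>2 / 2) / (2 * pi))" for z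
    have [measurable]: "\<rho> \<in> borel_measurable borel" unfolding \<rho>_def by measurable
    have "emeasure (distr cgauss borel uminus) A = (\<integral>\<^sup>+z. indicator A z \<partial>distr cgauss borel uminus)"
      by simp
    also have "\<dots> = (\<integral>\<^sup>+z. \<rho> z * indicator A (- z) \<partial>lborel)"
      by (simp add: nn_integral_distr nn_integral_cgauss \<rho>_def del: nn_integral_indicator)
    also have "\<dots> = ennreal ((cmod (-1))\<^sup>2) * (\<integral>\<^sup>+z. \<rho> (0 + -1 * z) * indicator A (- (0 + -1 * z)) \<partial>lborel)"
      by (rule nn_integral_complex_affine) auto
    also have "\<dots> = (\<integral>\<^sup>+z. indicator A z \<partial>cgauss)"
      by (simp add: nn_integral_cgauss \<rho>_def del: nn_integral_indicator)
    finally show "emeasure (distr cgauss borel uminus) A = emeasure cgauss A" by simp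
  qed simp
  then have "(\<integral>z. z \<partial>cgauss) = (\<integral>z. z \<partial>distr cgauss borel uminus)" by simp
  also have "\<dots> = - (\<integral>z. z \<partial>cgauss)" by (subst integral_distr) auto
  finally show ?thesis by simp
qed

text \<open>
  The unitary change of variables takes the combination \<open>a \<xi> + b \<zeta>\<close> to the first coordinate axis, so that
  jointly with one of its summands it is expressed through a multiple of a single variable \<open>u\<close>.
\<close>

lemma cgauss_joint_law:
  assumes r: "r > 0" "r\<^sup>2 = (cmod a)\<^sup>2 + (cmod b)\<^sup>2"
  shows "distr (cgauss \<Otimes>\<^sub>M cgauss) (borel \<Otimes>\<^sub>M borel) (\<lambda>(\<xi>, \<zeta>). (\<xi>, a * \<xi> + b * \<zeta>))
    = distr (cgauss \<Otimes>\<^sub>M cgauss) (borel \<Otimes>\<^sub>M borel) (\<lambda>(u, v). ((cnj a * u - b * v) / of_real r, of_real r * u))"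
    (is "?L = ?R")
proof -
  define a' b' where "a' = a / of_real r" and "b' = b / of_real r"
  have "(cmod a')\<^sup>2 + (cmod b')\<^sup>2 = ((cmod a)\<^sup>2 + (cmod b)\<^sup>2) / r\<^sup>2"
    using r(1) by (simp add: a'_def b'_def norm_divide power_divide add_divide_distrib)
  then have ab: "(cmod a')\<^sup>2 + (cmod b')\<^sup>2 = 1" unfolding r(2)[symmetric] using r(1) by simp
  have abr: "a * cnj a + b * cnj b = (of_real r)\<^sup>2"
  proof -
    have "complex_of_real (r\<^sup>2) = a * cnj a + b * cnj b"
      unfolding r(2) of_real_add complex_norm_square ..
    then show ?thesis by simp
  qed
  have inv: "(cnj a * (a' * x + b' * y) - b * (- cnj b' * x + cnj a' * y)) / of_real r = x"
    "of_real r * (a' * x + b' * y) = a * x + b * y" for x y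
  proof -
    have "(cnj a * (a' * x + b' * y) - b * (- cnj b' * x + cnj a' * y)) / of_real r
       = (a * cnj a + b * cnj b) * x / (of_real r)\<^sup>2"
      using r by (simp add: a'_def b'_def field_simps power2_eq_square)
    then show "(cnj a * (a' * x + b' * y) - b * (- cnj b' * x + cnj a' * y)) / of_real r = x"
      using r unfolding abr by simp
    show "of_real r * (a' * x + b' * y) = a * x + b * y"
      using r by (simp add: a'_def b'_def field_simps)
  qed
  have inv': "(cnj a * (a' * x + b' * y) - b * (cnj a' * y - cnj b' * x)) / of_real r = x" for x y
    using inv(1)[of x y] by simp
  have "?R = distr (distr (cgauss \<Otimes>\<^sub>M cgauss) (borel \<Otimes>\<^sub>M borel)
      (\<lambda>(\<xi>, \<zeta>). (a' * \<xi> + b' * \<zeta>, - cnj b' * \<xi> + cnj a' * \<zeta>))) (borel \<Otimes>\<^sub>M borel)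
      (\<lambda>(u, v). ((cnj a * u - b * v) / of_real r, of_real r * u))"
    unfolding cgauss_unitary_invariant[OF ab] ..
  also have "\<dots> = ?L"
    by (subst distr_distr) (auto simp: comp_def split_beta' inv' inv(2) intro!: distr_cong)
  finally show ?thesis ..
qed

lemma cgauss_linear_combination:
  assumes "r \<ge> 0" "r\<^sup>2 = (cmod a)\<^sup>2 + (cmod b)\<^sup>2"
  shows "distr (cgauss \<Otimes>\<^sub>M cgauss) borel (\<lambda>(\<xi>, \<zeta>). a * \<xi> + b * \<zeta>) = distr cgauss borel (\<lambda>z. of_real r * z)"
proof -
  interpret C: prob_space cgauss by (rule prob_space_cgauss)
  interpret CC: pair_prob_space cgauss cgauss ..
  show ?thesis
  proof (cases "r = 0")
    case True
    then have "a = 0" "b = 0" using assms by (auto simp: add_nonneg_eq_0_iff)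
    then show ?thesis using True by (simp add: C.distr_const CC.distr_const split_beta')
  next
    case False
    then have r: "r > 0" using assms by simp
    have "distr (cgauss \<Otimes>\<^sub>M cgauss) borel (\<lambda>(\<xi>, \<zeta>). a * \<xi> + b * \<zeta>)
      = distr (distr (cgauss \<Otimes>\<^sub>M cgauss) (borel \<Otimes>\<^sub>M borel) (\<lambda>(\<xi>, \<zeta>). (\<xi>, a * \<xi> + b * \<zeta>))) borel snd"
      by (subst distr_distr) (auto simp: comp_def split_beta')
    also have "\<dots> = distr (cgauss \<Otimes>\<^sub>M cgauss) borel (\<lambda>w. of_real r * fst w)"
      unfolding cgauss_joint_law[OF r assms(2)]
      by (subst distr_distr) (auto simp: comp_def split_beta')
    also have "\<dots> = distr (distr (cgauss \<Otimes>\<^sub>M cgauss) cgauss fst) borel (\<lambda>z. of_real r * z)"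
      by (subst distr_distr) (auto simp: comp_def)
    also have "distr (cgauss \<Otimes>\<^sub>M cgauss) cgauss fst = cgauss"
      by (rule C.distr_pair_fst)
    finally show ?thesis .
  qed
qed

section \<open>Linear combinations of independent complex Gaussian variables\<close>

locale complex_gaussian_family = prob_space M for M :: "'a measure" +
  fixes I :: "'i set" and \<eta> :: "'i \<Rightarrow> 'a \<Rightarrow> complex"
  assumes finite_I: "finite I"
    and indep: "indep_vars (\<lambda>_. borel) \<eta> I"
    and law: "\<And>i. i \<in> I \<Longrightarrow> distr M borel (\<eta> i) = cgauss"
begin

lemma measurable_eta [measurable]: "i \<in> I \<Longrightarrow> \<eta> i \<in> borel_measurable M"
  using indep by (auto simp: indep_vars_def)

text \<open>
  Stated with a hypothesis on the law of the sum over \<open>J\<close>, so that it serves both inside the induction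
  that determines this law and after it.
\<close>

lemma law_coefficient_pair:
  assumes k: "k \<in> I" "k \<notin> J" and J: "J \<subseteq> I"
    and Y: "distr M borel (\<lambda>\<omega>. \<Sum>j\<in>J. a j * \<eta> j \<omega>) = distr cgauss borel (\<lambda>z. of_real s * z)"
  shows "distr M (borel \<Otimes>\<^sub>M borel) (\<lambda>\<omega>. (\<eta> k \<omega>, \<Sum>j\<in>J. a j * \<eta> j \<omega>))
     = distr (cgauss \<Otimes>\<^sub>M cgauss) (borel \<Otimes>\<^sub>M borel) (\<lambda>(\<xi>, \<zeta>). (\<xi>, of_real s * \<zeta>))"
proof -
  interpret C: prob_space cgauss by (rule prob_space_cgauss)
  have [measurable]: "\<And>j. j \<in> J \<Longrightarrow> \<eta> j \<in> borel_measurable M" using J by auto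
  have "indep_var
    borel ((\<lambda>f. f k) \<circ> (\<lambda>\<omega>. restrict (\<lambda>i. \<eta> i \<omega>) {k}))
    borel ((\<lambda>f. \<Sum>j\<in>J. a j * f j) \<circ> (\<lambda>\<omega>. restrict (\<lambda>i. \<eta> i \<omega>) J))"
    using k J by (intro indep_var_compose[OF indep_var_restrict[OF indep]]) auto
  also have "(\<lambda>f. f k) \<circ> (\<lambda>\<omega>. restrict (\<lambda>i. \<eta> i \<omega>) {k}) = \<eta> k" by auto
  also have "(\<lambda>f. \<Sum>j\<in>J. a j * f j) \<circ> (\<lambda>\<omega>. restrict (\<lambda>i. \<eta> i \<omega>) J) = (\<lambda>\<omega>. \<Sum>j\<in>J. a j * \<eta> j \<omega>)"
    by (auto cong: rev_conj_cong)
  finally have "distr M borel (\<eta> k) \<Otimes>\<^sub>M distr M borel (\<lambda>\<omega>. \<Sum>j\<in>J. a j * \<eta> j \<omega>)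
     = distr M (borel \<Otimes>\<^sub>M borel) (\<lambda>\<omega>. (\<eta> k \<omega>, \<Sum>j\<in>J. a j * \<eta> j \<omega>))"
    unfolding indep_var_distribution_eq by blast
  then have "distr M (borel \<Otimes>\<^sub>M borel) (\<lambda>\<omega>. (\<eta> k \<omega>, \<Sum>j\<in>J. a j * \<eta> j \<omega>))
      = cgauss \<Otimes>\<^sub>M distr cgauss borel (\<lambda>z. of_real s * z)"
    using law[OF k(1)] Y by simp
  also have "\<dots> = distr cgauss borel (\<lambda>z. z) \<Otimes>\<^sub>M distr cgauss borel (\<lambda>z. of_real s * z)"
    by (subst distr_id2) auto
  also have "\<dots> = distr (cgauss \<Otimes>\<^sub>M cgauss) (borel \<Otimes>\<^sub>M borel) (\<lambda>(\<xi>, \<zeta>). (\<xi>, of_real s * \<zeta>))"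
    by (rule pair_measure_distr) (auto intro!: prob_space_imp_sigma_finite C.prob_space_distr)
  finally show ?thesis .
qed

lemma law_linear_combination:
  assumes "J \<subseteq> I"
  shows "distr M borel (\<lambda>\<omega>. \<Sum>j\<in>J. a j * \<eta> j \<omega>)
    = distr cgauss borel (\<lambda>z. of_real (sqrt (\<Sum>j\<in>J. (cmod (a j))\<^sup>2)) * z)"
  using finite_subset[OF assms finite_I] assms
proof (induction J rule: finite_induct)
  case empty
  interpret C: prob_space cgauss by (rule prob_space_cgauss)
  show ?case by (simp add: distr_const C.distr_const)
next
  case (insert k J)
  define s where "s = sqrt (\<Sum>j\<in>J. (cmod (a j))\<^sup>2)"
  define r where "r = sqrt (\<Sum>j\<in>insert k J. (cmod (a j))\<^sup>2)"
  have [measurable]: "k \<in> I" "\<And>j. j \<in> J \<Longrightarrow> \<eta> j \<in> borel_measurable M"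
    using insert.prems by auto
  have s: "s\<^sup>2 = (\<Sum>j\<in>J. (cmod (a j))\<^sup>2)" by (simp add: s_def sum_nonneg)
  have r: "r \<ge> 0" "r\<^sup>2 = (cmod (a k))\<^sup>2 + (cmod (of_real s))\<^sup>2"
    using insert.hyps by (simp_all add: r_def s sum_nonneg)
  have pair: "distr M (borel \<Otimes>\<^sub>M borel) (\<lambda>\<omega>. (\<eta> k \<omega>, \<Sum>j\<in>J. a j * \<eta> j \<omega>))
      = distr (cgauss \<Otimes>\<^sub>M cgauss) (borel \<Otimes>\<^sub>M borel) (\<lambda>(\<xi>, \<zeta>). (\<xi>, of_real s * \<zeta>))"
    using insert.hyps insert.prems insert.IH unfolding s_def by (intro law_coefficient_pair) auto
  have "distr M borel (\<lambda>\<omega>. \<Sum>j\<in>insert k J. a j * \<eta> j \<omega>)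
      = distr (distr M (borel \<Otimes>\<^sub>M borel) (\<lambda>\<omega>. (\<eta> k \<omega>, \<Sum>j\<in>J. a j * \<eta> j \<omega>))) borel (\<lambda>(x, y). a k * x + y)"
    using insert.hyps by (subst distr_distr) (auto simp: comp_def)
  also have "\<dots> = distr (cgauss \<Otimes>\<^sub>M cgauss) borel (\<lambda>(\<xi>, \<zeta>). a k * \<xi> + of_real s * \<zeta>)"
    unfolding pair by (subst distr_distr) (auto simp: comp_def split_beta')
  also have "\<dots> = distr cgauss borel (\<lambda>z. of_real r * z)"
    by (rule cgauss_linear_combination[OF r])
  finally show ?case unfolding r_def .
qed

lemma law_coefficient_and_combination:
  assumes k: "k \<in> I" and pos: "(\<Sum>j\<in>I. (cmod (a j))\<^sup>2) > 0"
  defines "r \<equiv> sqrt (\<Sum>j\<in>I. (cmod (a j))\<^sup>2)" and "s \<equiv> sqrt (\<Sum>j\<in>I - {k}. (cmod (a j))\<^sup>2)"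
  shows "distr M (borel \<Otimes>\<^sub>M borel) (\<lambda>\<omega>. (\<eta> k \<omega>, \<Sum>j\<in>I. a j * \<eta> j \<omega>))
    = distr (cgauss \<Otimes>\<^sub>M cgauss) (borel \<Otimes>\<^sub>M borel)
        (\<lambda>(u, v). ((cnj (a k) * u - of_real s * v) / of_real r, of_real r * u))"
proof -
  note [measurable] = k
  have rpos: "r > 0" using pos by (simp add: r_def)
  have s2: "s\<^sup>2 = (\<Sum>j\<in>I - {k}. (cmod (a j))\<^sup>2)" by (simp add: s_def sum_nonneg)
  have r2: "r\<^sup>2 = (cmod (a k))\<^sup>2 + (cmod (of_real s))\<^sup>2"
    using k finite_I by (simp add: r_def s2 sum_nonneg sum.remove)
  have pair: "distr M (borel \<Otimes>\<^sub>M borel) (\<lambda>\<omega>. (\<eta> k \<omega>, \<Sum>j\<in>I - {k}. a j * \<eta> j \<omega>))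
      = distr (cgauss \<Otimes>\<^sub>M cgauss) (borel \<Otimes>\<^sub>M borel) (\<lambda>(\<xi>, \<zeta>). (\<xi>, of_real s * \<zeta>))"
    using k unfolding s_def by (intro law_coefficient_pair law_linear_combination) auto
  have split: "(\<Sum>j\<in>I. a j * \<eta> j \<omega>) = a k * \<eta> k \<omega> + (\<Sum>j\<in>I - {k}. a j * \<eta> j \<omega>)" for \<omega>
    using k finite_I by (simp add: sum.remove)
  have "distr M (borel \<Otimes>\<^sub>M borel) (\<lambda>\<omega>. (\<eta> k \<omega>, \<Sum>j\<in>I. a j * \<eta> j \<omega>))
      = distr (distr M (borel \<Otimes>\<^sub>M borel) (\<lambda>\<omega>. (\<eta> k \<omega>, \<Sum>j\<in>I - {k}. a j * \<eta> j \<omega>)))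
          (borel \<Otimes>\<^sub>M borel) (\<lambda>(x, y). (x, a k * x + y))"
    unfolding split by (subst distr_distr) (auto simp: comp_def)
  also have "\<dots> = distr (cgauss \<Otimes>\<^sub>M cgauss) (borel \<Otimes>\<^sub>M borel) (\<lambda>(\<xi>, \<zeta>). (\<xi>, a k * \<xi> + of_real s * \<zeta>))"
    unfolding pair by (subst distr_distr) (auto simp: comp_def split_beta')
  also have "\<dots> = distr (cgauss \<Otimes>\<^sub>M cgauss) (borel \<Otimes>\<^sub>M borel)
        (\<lambda>(u, v). ((cnj (a k) * u - of_real s * v) / of_real r, of_real r * u))"
    using cgauss_joint_law[OF rpos r2] by simp
  finally show ?thesis .
qed

text \<open>
  As \<open>inverse 0 = \<infinity>\<close> in the extended nonnegative reals, finiteness of this integral also excludes that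
  the combination vanishes with positive probability.
\<close>

lemma nn_integral_inverse_linear_combination:
  assumes "(\<Sum>j\<in>I. (cmod (a j))\<^sup>2) > 0"
  shows "(\<integral>\<^sup>+\<omega>. inverse (ennreal (cmod (\<Sum>j\<in>I. a j * \<eta> j \<omega>))) \<partial>M)
    = ennreal (1 / sqrt (\<Sum>j\<in>I. (cmod (a j))\<^sup>2)) * (\<integral>\<^sup>+z. inverse (ennreal (cmod z)) \<partial>cgauss)"
proof -
  define r where "r = sqrt (\<Sum>j\<in>I. (cmod (a j))\<^sup>2)"
  have r: "r > 0" using assms by (simp add: r_def)
  have "(\<integral>\<^sup>+\<omega>. inverse (ennreal (cmod (\<Sum>j\<in>I. a j * \<eta> j \<omega>))) \<partial>M)
      = (\<integral>\<^sup>+y. inverse (ennreal (cmod y)) \<partial>distr M borel (\<lambda>\<omega>. \<Sum>j\<in>I. a j * \<eta> j \<omega>))"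
    by (simp add: nn_integral_distr)
  also have "\<dots> = (\<integral>\<^sup>+z. inverse (ennreal (cmod (of_real r * z))) \<partial>cgauss)"
    unfolding law_linear_combination[OF order_refl] r_def by (simp add: nn_integral_distr)
  also have "\<dots> = (\<integral>\<^sup>+z. ennreal (1 / r) * inverse (ennreal (cmod z)) \<partial>cgauss)"
  proof (rule nn_integral_cong)
    fix z :: complex
    show "inverse (ennreal (cmod (of_real r * z))) = ennreal (1 / r) * inverse (ennreal (cmod z))"
      using r by (cases "z = 0")
        (auto simp: norm_mult inverse_ennreal ennreal_mult'[symmetric] field_simps ennreal_mult_eq_top_iff)
  qed
  finally show ?thesis unfolding r_def by (simp add: nn_integral_cmult)
qed

text \<open>
  A constant independent of the coefficients that bounds the mean of \<open>\<bar>\<eta>\<^sub>k / Y\<bar>\<close> for every combination \<open>Y\<close>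
  whose coefficient vector has norm one.
\<close>

definition ratio_bound :: real where
  "ratio_bound = 1 + (\<integral>z. cmod z \<partial>cgauss) * (\<integral>z. cmod (inverse z) \<partial>cgauss)"

text \<open>
  In the rotated coordinates of \<open>law_coefficient_and_combination\<close> the quotient is a constant plus a
  multiple of \<open>v / u\<close> with \<open>u\<close>, \<open>v\<close> independent, and the latter has mean \<open>E v \<cdot> E (1/u) = 0\<close>.
\<close>

lemma coefficient_quotient:
  assumes k: "k \<in> I" and pos: "(\<Sum>j\<in>I. (cmod (a j))\<^sup>2) > 0"
  defines "Y \<equiv> \<lambda>\<omega>. \<Sum>j\<in>I. a j * \<eta> j \<omega>" and "S \<equiv> (\<Sum>j\<in>I. (cmod (a j))\<^sup>2)"
  shows "integrable M (\<lambda>\<omega>. \<eta> k \<omega> / Y \<omega>)"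
    and "expectation (\<lambda>\<omega>. \<eta> k \<omega> / Y \<omega>) = cnj (a k) / of_real S"
    and "expectation (\<lambda>\<omega>. cmod (\<eta> k \<omega> / Y \<omega>)) \<le> ratio_bound / sqrt S"
proof -
  interpret C: prob_space cgauss by (rule prob_space_cgauss)
  interpret CC: pair_prob_space cgauss cgauss ..
  note [measurable] = k
  have [measurable]: "Y \<in> borel_measurable M" unfolding Y_def by measurable
  define r where "r = sqrt S"
  define s where "s = sqrt (\<Sum>j\<in>I - {k}. (cmod (a j))\<^sup>2)"
  have r: "r > 0" "r\<^sup>2 = S" using pos by (simp_all add: r_def S_def)
  have s: "0 \<le> s" "s \<le> r"
    unfolding s_def r_def S_def using finite_I by (auto intro!: sum_nonneg sum_mono2)
  have ak: "cmod (a k) \<le> r"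
  proof -
    have "(cmod (a k))\<^sup>2 \<le> S" unfolding S_def using finite_I k by (intro member_le_sum) auto
    then show ?thesis unfolding r_def by (simp add: real_le_rsqrt)
  qed
  have law: "distr M (borel \<Otimes>\<^sub>M borel) (\<lambda>\<omega>. (\<eta> k \<omega>, Y \<omega>)) = distr (cgauss \<Otimes>\<^sub>M cgauss) (borel \<Otimes>\<^sub>M borel)
        (\<lambda>(u, v). ((cnj (a k) * u - of_real s * v) / of_real r, of_real r * u))"
    unfolding Y_def r_def S_def s_def by (rule law_coefficient_and_combination) (use k pos in auto)
  define q where "q = (\<lambda>(x, y). x / y :: complex)"
  have [measurable]: "q \<in> borel_measurable (borel \<Otimes>\<^sub>M borel)" unfolding q_def by measurable
  define \<phi> where "\<phi> = (\<lambda>(u, v :: complex).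
      cnj (a k) / of_real S * (u * inverse u) - of_real (s / S) * (inverse u * v))"
  have q\<phi>: "q ((cnj (a k) * u - of_real s * v) / of_real r, of_real r * u) = \<phi> (u, v)" for u v
    using r by (cases "u = 0")
      (auto simp: q_def \<phi>_def field_simps power2_eq_square simp flip: r(2))
  have uu: "AE u in cgauss. u * inverse u = 1"
    unfolding cgauss_def using AE_lborel_singleton[of "0::complex"]
    by (subst AE_density) (auto elim!: eventually_mono)
  have int_uu: "integrable cgauss (\<lambda>u. u * inverse u)" "(\<integral>u. u * inverse u \<partial>cgauss) = 1"
  proof -
    show "integrable cgauss (\<lambda>u. u * inverse u)"
      by (subst integrable_cong_AE[where g = "\<lambda>_. 1"]) (use uu in auto)
    have "(\<integral>u. u * inverse u \<partial>cgauss) = (\<integral>u. 1 \<partial>cgauss)"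
      by (rule integral_cong_AE) (use uu in auto)
    then show "(\<integral>u. u * inverse u \<partial>cgauss) = 1" using C.prob_space by simp
  qed
  have i1: "integrable (cgauss \<Otimes>\<^sub>M cgauss) (\<lambda>(u, v :: complex). u * inverse u)"
    "(\<integral>(u, v). u * inverse u \<partial>(cgauss \<Otimes>\<^sub>M cgauss)) = 1"
    using integrable_cgauss_times[OF int_uu(1), of "\<lambda>_. 1"] int_uu(2) C.prob_space by simp_all
  have i2: "integrable (cgauss \<Otimes>\<^sub>M cgauss) (\<lambda>(u, v). inverse u * v)"
    "(\<integral>(u, v). inverse u * v \<partial>(cgauss \<Otimes>\<^sub>M cgauss)) = 0"
    using integrable_cgauss_times[OF integrable_cgauss_inverse integrable_cgauss_ident]
    by (simp_all add: integral_cgauss_ident)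
  have int\<phi>: "integrable (cgauss \<Otimes>\<^sub>M cgauss) \<phi>"
    using i1(1) i2(1) unfolding \<phi>_def split_beta' by auto
  have val\<phi>: "(\<integral>w. \<phi> w \<partial>(cgauss \<Otimes>\<^sub>M cgauss)) = cnj (a k) / of_real S"
    using i1 i2 unfolding \<phi>_def split_beta' by (simp add: Bochner_Integration.integral_diff)
  have transfer: "integrable M (\<lambda>\<omega>. q (\<eta> k \<omega>, Y \<omega>)) = integrable (cgauss \<Otimes>\<^sub>M cgauss) \<phi>"
    "(\<integral>\<omega>. q (\<eta> k \<omega>, Y \<omega>) \<partial>M) = (\<integral>w. \<phi> w \<partial>(cgauss \<Otimes>\<^sub>M cgauss))"
    "(\<integral>\<omega>. cmod (q (\<eta> k \<omega>, Y \<omega>)) \<partial>M) = (\<integral>w. cmod (\<phi> w) \<partial>(cgauss \<Otimes>\<^sub>M cgauss))"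
  proof -
    have T [measurable]: "(\<lambda>(u, v). ((cnj (a k) * u - of_real s * v) / of_real r, of_real r * u))
        \<in> cgauss \<Otimes>\<^sub>M cgauss \<rightarrow>\<^sub>M borel \<Otimes>\<^sub>M (borel :: complex measure)"
      by measurable
    have q\<phi>': "q (case w of (u, v) \<Rightarrow> ((cnj (a k) * u - of_real s * v) / of_real r, of_real r * u)) = \<phi> w" for w
      using q\<phi> by (cases w) auto
    have "integrable M (\<lambda>\<omega>. q (\<eta> k \<omega>, Y \<omega>)) = integrable (distr M (borel \<Otimes>\<^sub>M borel) (\<lambda>\<omega>. (\<eta> k \<omega>, Y \<omega>))) q"
      by (subst integrable_distr_eq) auto
    also have "\<dots> = integrable (cgauss \<Otimes>\<^sub>M cgauss) \<phi>"
      unfolding law by (subst integrable_distr_eq[OF T]) (auto simp: q\<phi>')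
    finally show "integrable M (\<lambda>\<omega>. q (\<eta> k \<omega>, Y \<omega>)) = integrable (cgauss \<Otimes>\<^sub>M cgauss) \<phi>" .
    have "(\<integral>\<omega>. q (\<eta> k \<omega>, Y \<omega>) \<partial>M) = (\<integral>w. q w \<partial>distr M (borel \<Otimes>\<^sub>M borel) (\<lambda>\<omega>. (\<eta> k \<omega>, Y \<omega>)))"
      by (subst integral_distr) auto
    also have "\<dots> = (\<integral>w. \<phi> w \<partial>(cgauss \<Otimes>\<^sub>M cgauss))"
      unfolding law by (subst integral_distr[OF T]) (auto simp: q\<phi>')
    finally show "(\<integral>\<omega>. q (\<eta> k \<omega>, Y \<omega>) \<partial>M) = (\<integral>w. \<phi> w \<partial>(cgauss \<Otimes>\<^sub>M cgauss))" .
    have "(\<integral>\<omega>. cmod (q (\<eta> k \<omega>, Y \<omega>)) \<partial>M) = (\<integral>w. cmod (q w) \<partial>distr M (borel \<Otimes>\<^sub>M borel) (\<lambda>\<omega>. (\<eta> k \<omega>, Y \<omega>)))"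
      by (subst integral_distr) auto
    also have "\<dots> = (\<integral>w. cmod (\<phi> w) \<partial>(cgauss \<Otimes>\<^sub>M cgauss))"
      unfolding law by (subst integral_distr[OF T]) (auto simp: q\<phi>')
    finally show "(\<integral>\<omega>. cmod (q (\<eta> k \<omega>, Y \<omega>)) \<partial>M) = (\<integral>w. cmod (\<phi> w) \<partial>(cgauss \<Otimes>\<^sub>M cgauss))" .
  qed
  show "integrable M (\<lambda>\<omega>. \<eta> k \<omega> / Y \<omega>)" "expectation (\<lambda>\<omega>. \<eta> k \<omega> / Y \<omega>) = cnj (a k) / of_real S"
    using transfer(1,2) int\<phi> val\<phi> by (simp_all add: q_def)
  define A B where "A = (\<integral>z. cmod z \<partial>cgauss)" and "B = (\<integral>z. cmod (inverse z) \<partial>cgauss)"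
  have AB: "A \<ge> 0" "B \<ge> 0" by (simp_all add: A_def B_def)
  have n2: "integrable (cgauss \<Otimes>\<^sub>M cgauss) (\<lambda>(u, v). cmod (inverse u) * cmod v)"
    "(\<integral>(u, v). cmod (inverse u) * cmod v \<partial>(cgauss \<Otimes>\<^sub>M cgauss)) = B * A"
  proof -
    show i: "integrable (cgauss \<Otimes>\<^sub>M cgauss) (\<lambda>(u, v). cmod (inverse u) * cmod v)"
      using integrable_norm[OF i2(1)] by (simp add: split_beta' norm_mult)
    show "(\<integral>(u, v). cmod (inverse u) * cmod v \<partial>(cgauss \<Otimes>\<^sub>M cgauss)) = B * A"
      unfolding A_def B_def by (subst CC.integral_fst[symmetric]) (use i in simp_all)
  qed
  have "(\<integral>w. cmod (\<phi> w) \<partial>(cgauss \<Otimes>\<^sub>M cgauss))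
      \<le> (\<integral>w. r / S + r / S * (case w of (u, v) \<Rightarrow> cmod (inverse u) * cmod v) \<partial>(cgauss \<Otimes>\<^sub>M cgauss))"
  proof (rule integral_mono)
    show "integrable (cgauss \<Otimes>\<^sub>M cgauss) (\<lambda>w. cmod (\<phi> w))" using int\<phi> by auto
    show "integrable (cgauss \<Otimes>\<^sub>M cgauss) (\<lambda>w. r / S + r / S * (case w of (u, v) \<Rightarrow> cmod (inverse u) * cmod v))"
      using n2(1) by auto
    fix w :: "complex \<times> complex"
    obtain u v where w: "w = (u, v)" by (cases w)
    have S: "S > 0" using pos S_def by simp
    have uu1: "cmod u * inverse (cmod u) \<le> 1" by (cases "u = 0") auto
    have "cmod (\<phi> w) \<le> cmod (cnj (a k) / of_real S * (u * inverse u)) + cmod (of_real (s / S) * (inverse u * v))"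
      unfolding w \<phi>_def by (simp add: norm_triangle_ineq4)
    also have "\<dots> \<le> r / S * 1 + r / S * (cmod (inverse u) * cmod v)"
      unfolding norm_mult norm_divide norm_of_real using S s ak
      by (intro add_mono mult_mono) (auto simp: norm_inverse divide_right_mono uu1)
    finally show "cmod (\<phi> w) \<le> r / S + r / S * (case w of (u, v) \<Rightarrow> cmod (inverse u) * cmod v)"
      by (simp add: w)
  qed
  also have "\<dots> = r / S * ratio_bound"
    using n2 unfolding ratio_bound_def A_def[symmetric] B_def[symmetric]
    by (simp add: CC.prob_space algebra_simps)
  also have "r / S = 1 / r" using r by (simp add: field_simps power2_eq_square flip: r(2))
  finally show "expectation (\<lambda>\<omega>. cmod (\<eta> k \<omega> / Y \<omega>)) \<le> ratio_bound / sqrt S"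
    using transfer(3) by (simp add: q_def r_def)
qed

text \<open>
  The mean of \<open>X / Y\<close> is the regression coefficient \<open>E (X cnj Y) / E \<bar>Y\<bar>\<^sup>2\<close>. The bound on the mean of
  \<open>\<bar>X / Y\<bar>\<close> is what permits Fubini along the sides of a rectangle.
\<close>

lemma expectation_quotient:
  fixes a b :: "'i \<Rightarrow> complex"
  assumes pos: "(\<Sum>j\<in>I. (cmod (a j))\<^sup>2) > 0"
  defines "Y \<equiv> \<lambda>\<omega>. \<Sum>j\<in>I. a j * \<eta> j \<omega>" and "S \<equiv> (\<Sum>j\<in>I. (cmod (a j))\<^sup>2)"
    and "X \<equiv> \<lambda>\<omega>. \<Sum>j\<in>I. b j * \<eta> j \<omega>"
  shows "integrable M (\<lambda>\<omega>. X \<omega> / Y \<omega>)"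
    and "expectation (\<lambda>\<omega>. X \<omega> / Y \<omega>) = (\<Sum>j\<in>I. b j * cnj (a j)) / of_real S"
    and "expectation (\<lambda>\<omega>. cmod (X \<omega> / Y \<omega>)) \<le> (\<Sum>j\<in>I. cmod (b j)) * ratio_bound / sqrt S"
proof -
  have q: "integrable M (\<lambda>\<omega>. \<eta> k \<omega> / Y \<omega>)"
    "expectation (\<lambda>\<omega>. \<eta> k \<omega> / Y \<omega>) = cnj (a k) / of_real S"
    "expectation (\<lambda>\<omega>. cmod (\<eta> k \<omega> / Y \<omega>)) \<le> ratio_bound / sqrt S" if "k \<in> I" for k
    unfolding Y_def S_def by (rule coefficient_quotient[OF that pos])+
  have X: "X \<omega> / Y \<omega> = (\<Sum>k\<in>I. b k * (\<eta> k \<omega> / Y \<omega>))" for \<omega>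
    by (simp add: X_def sum_divide_distrib)
  show int: "integrable M (\<lambda>\<omega>. X \<omega> / Y \<omega>)"
    unfolding X using q(1) by (intro Bochner_Integration.integrable_sum integrable_mult_right)
  show "expectation (\<lambda>\<omega>. X \<omega> / Y \<omega>) = (\<Sum>j\<in>I. b j * cnj (a j)) / of_real S"
    unfolding X using q(1,2) by (subst Bochner_Integration.integral_sum) 
      (auto simp: sum_divide_distrib simp flip: times_divide_eq_right)
  have "expectation (\<lambda>\<omega>. cmod (X \<omega> / Y \<omega>)) \<le> expectation (\<lambda>\<omega>. \<Sum>k\<in>I. cmod (b k) * cmod (\<eta> k \<omega> / Y \<omega>))"
  proof (rule integral_mono)
    show "integrable M (\<lambda>\<omega>. cmod (X \<omega> / Y \<omega>))" using int by auto
    show "integrable M (\<lambda>\<omega>. \<Sum>k\<in>I. cmod (b k) * cmod (\<eta> k \<omega> / Y \<omega>))" using q(1) by auto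
    show "cmod (X \<omega> / Y \<omega>) \<le> (\<Sum>k\<in>I. cmod (b k) * cmod (\<eta> k \<omega> / Y \<omega>))" for \<omega>
      unfolding X norm_mult[symmetric] by (rule norm_sum)
  qed
  also have "\<dots> = (\<Sum>k\<in>I. cmod (b k) * expectation (\<lambda>\<omega>. cmod (\<eta> k \<omega> / Y \<omega>)))"
    using q(1) by (subst Bochner_Integration.integral_sum) auto
  also have "\<dots> \<le> (\<Sum>k\<in>I. cmod (b k) * (ratio_bound / sqrt S))"
    using q(3) by (intro sum_mono mult_left_mono) auto
  finally show "expectation (\<lambda>\<omega>. cmod (X \<omega> / Y \<omega>)) \<le> (\<Sum>j\<in>I. cmod (b j)) * ratio_bound / sqrt S"
    by (simp add: sum_distrib_right sum_divide_distrib)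
qed

end

section \<open>Counting zeros in a rectangle\<close>

text \<open>
  The integral of \<open>f(z) dz\<close> around the rectangle \<open>[x0, x1] \<times> [y0, y1]\<close>, written as four Lebesgue
  integrals over fixed real intervals so that Fubini and the one-variable fundamental theorem apply.
\<close>

definition boundary_integral :: "(complex \<Rightarrow> complex) \<Rightarrow> real \<Rightarrow> real \<Rightarrow> real \<Rightarrow> real \<Rightarrow> complex" where
  "boundary_integral f x0 x1 y0 y1 =
     (LBINT x:{x0..x1}. f (Complex x y0)) - (LBINT x:{x0..x1}. f (Complex x y1)) +
     \<i> * (LBINT y:{y0..y1}. f (Complex x1 y)) - \<i> * (LBINT y:{y0..y1}. f (Complex x0 y))"

lemma has_contour_integral_linepath_same_Im:
  assumes "Im z = c" "Im z' = c" "Re z = a" "Re z' = b" "a < b"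
    and "((\<lambda>x. f (Complex x c)) has_integral I) {a..b}"
  shows "(f has_contour_integral I) (linepath z z')"
proof -
  have "((\<lambda>w. f (w + \<i> * of_real c)) has_contour_integral I) (linepath (of_real a) (of_real b))"
    using assms(5,6) by (subst has_contour_integral_linepath_Reals_iff) (auto simp: Complex_eq)
  then have "((\<lambda>x. f (linepath (of_real a) (of_real b) x + \<i> * of_real c) * (of_real b - of_real a))
      has_integral I) {0..1}"
    by (simp add: has_contour_integral_linepath)
  also have "(\<lambda>x. f (linepath (of_real a) (of_real b) x + \<i> * of_real c) * (of_real b - of_real a))
      = (\<lambda>x. f (linepath z z' x) * (z' - z))"
    using assms(1-4) by (intro ext arg_cong2[of _ _ _ _ "(*)"] arg_cong[of _ _ f])
      (auto simp: linepath_def complex_eq_iff algebra_simps)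
  finally show ?thesis by (simp add: has_contour_integral_linepath)
qed

lemma set_lebesgue_integral_has_integral:
  fixes g :: "real \<Rightarrow> complex"
  assumes "continuous_on {a..b} g"
  shows "(g has_integral (LBINT x:{a..b}. g x)) {a..b}"
  using set_borel_integral_eq_integral[OF borel_integrable_atLeastAtMost'[OF assms]]
  by (simp add: has_integral_integrable_integral)

lemma has_contour_integral_rectpath:
  assumes xy: "x0 < x1" "y0 < y1"
    and cont: "continuous_on (path_image (rectpath (Complex x0 y0) (Complex x1 y1))) f"
  shows "(f has_contour_integral boundary_integral f x0 x1 y0 y1) (rectpath (Complex x0 y0) (Complex x1 y1))"
proof -
  have im: "path_image (rectpath (Complex x0 y0) (Complex x1 y1)) =
     {z. Re z \<in> {x0, x1} \<and> Im z \<in> {y0..y1}} \<union> {z. Im z \<in> {y0, y1} \<and> Re z \<in> {x0..x1}}"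
    using xy by (subst path_image_rectpath) auto
  have h: "continuous_on {x0..x1} (\<lambda>x. f (Complex x y))" if "y \<in> {y0, y1}" for y
  proof (rule continuous_on_compose2[OF cont])
    show "continuous_on {x0..x1} (\<lambda>x. Complex x y)" unfolding Complex_eq by (intro continuous_intros)
    show "(\<lambda>x. Complex x y) ` {x0..x1} \<subseteq> path_image (rectpath (Complex x0 y0) (Complex x1 y1))"
      unfolding im using that xy by auto
  qed
  have v: "continuous_on {y0..y1} (\<lambda>y. f (Complex x y))" if "x \<in> {x0, x1}" for x
  proof (rule continuous_on_compose2[OF cont])
    show "continuous_on {y0..y1} (\<lambda>y. Complex x y)" unfolding Complex_eq by (intro continuous_intros)
    show "(\<lambda>y. Complex x y) ` {y0..y1} \<subseteq> path_image (rectpath (Complex x0 y0) (Complex x1 y1))"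
      unfolding im using that xy by auto
  qed
  have H: "(f has_contour_integral (LBINT x:{x0..x1}. f (Complex x y))) (linepath (Complex x0 y) (Complex x1 y))"
    if "y \<in> {y0, y1}" for y
    by (rule has_contour_integral_linepath_same_Im[OF _ _ _ _ xy(1)
          set_lebesgue_integral_has_integral[OF h[OF that]]]) auto
  have V: "(f has_contour_integral \<i> * (LBINT y:{y0..y1}. f (Complex x y))) (linepath (Complex x y0) (Complex x y1))"
    if "x \<in> {x0, x1}" for x
    using set_lebesgue_integral_has_integral[OF v[OF that]] xy(2)
    by (subst has_contour_integral_linepath_same_Re_iff[where c = x and a = y0 and b = y1]) auto
  show ?thesis
    unfolding rectpath_def Let_def complex.sel boundary_integral_def
    using has_contour_integral_join[OF H[of y0] has_contour_integral_join[OF V[of x1]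
      has_contour_integral_join[OF has_contour_integral_reverse_linepath[OF H[of y1]]
        has_contour_integral_reverse_linepath[OF V[of x0]]]]]
    by (simp add: algebra_simps)
qed

lemma boundary_integral_sum_poles:
  assumes xy: "x0 < x1" "y0 < y1"
    and off: "\<And>w. w \<in># A \<Longrightarrow> w \<notin> path_image (rectpath (Complex x0 y0) (Complex x1 y1))"
  shows "boundary_integral (\<lambda>z. \<Sum>w\<in>#A. 1 / (z - w)) x0 x1 y0 y1 =
    2 * of_real pi * \<i> * of_nat (size {#w \<in># A. w \<in> box (Complex x0 y0) (Complex x1 y1)#})"
proof -
  let ?\<gamma> = "rectpath (Complex x0 y0) (Complex x1 y1)"
  have 1: "((\<lambda>z. 1 / (z - w)) has_contour_integral
      2 * of_real pi * \<i> * (if w \<in> box (Complex x0 y0) (Complex x1 y1) then 1 else 0)) ?\<gamma>"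
    if w: "w \<notin> path_image ?\<gamma>" for w
  proof -
    have "path_image ?\<gamma> = cbox (Complex x0 y0) (Complex x1 y1) - box (Complex x0 y0) (Complex x1 y1)"
      using xy by (intro path_image_rectpath_cbox_minus_box) auto
    then have "w \<notin> box (Complex x0 y0) (Complex x1 y1) \<Longrightarrow> w \<notin> cbox (Complex x0 y0) (Complex x1 y1)"
      using w by blast
    then have "winding_number ?\<gamma> w = (if w \<in> box (Complex x0 y0) (Complex x1 y1) then 1 else 0)"
      using xy by (simp add: winding_number_rectpath winding_number_rectpath_outside)
    then show ?thesis
      using has_contour_integral_winding_number[OF valid_path_rectpath w] by simp
  qed
  have "((\<lambda>z. \<Sum>w\<in>#A. 1 / (z - w)) has_contour_integral
      2 * of_real pi * \<i> * of_nat (size {#w \<in># A. w \<in> box (Complex x0 y0) (Complex x1 y1)#})) ?\<gamma>"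
    using off
  proof (induction A)
    case empty
    then show ?case by (simp add: has_contour_integral_0)
  next
    case (add w A)
    then show ?case
      using has_contour_integral_add[OF 1[of w] add.IH] by (auto simp: algebra_simps split: if_splits)
  qed
  moreover have "continuous_on (path_image ?\<gamma>) (\<lambda>z. \<Sum>w\<in>#A. 1 / (z - w))"
    using off by (induction A) (auto intro!: continuous_intros)
  ultimately show ?thesis
    using has_contour_integral_rectpath[OF xy] has_contour_integral_unique by blast
qed

lemma logarithmic_derivative_proots:
  fixes P :: "complex poly"
  assumes "poly P z \<noteq> 0"
  shows "poly (pderiv P) z / poly P z = (\<Sum>w\<in>#proots P. 1 / (z - w))"
proof -
  have "poly (pderiv (\<Prod>w\<in>#A. [:-w, 1:])) z = poly (\<Prod>w\<in>#A. [:-w, 1:]) z * (\<Sum>w\<in>#A. 1 / (z - w))"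
    if "z \<notin># A" for A
    using that
  proof (induction A)
    case (add x A)
    let ?Q = "\<Prod>w\<in>#A. [:-w, 1:]"
    have "poly (pderiv ([:-x, 1:] * ?Q)) z = (z - x) * poly (pderiv ?Q) z + poly ?Q z"
      unfolding pderiv_mult poly_add poly_mult by (simp add: pderiv_pCons)
    also have "\<dots> = (z - x) * poly ?Q z * (1 / (z - x) + (\<Sum>w\<in>#A. 1 / (z - w)))"
      using add by (simp add: field_simps)
    also have "(z - x) * poly ?Q z = poly ([:-x, 1:] * ?Q) z"
      unfolding poly_mult by simp
    finally show ?case by (simp del: mult_pCons_left)
  qed simp
  moreover have "z \<notin># proots P"
  proof -
    have "P \<noteq> 0" using assms by auto
    then show ?thesis using assms by simp
  qed
  ultimately have *: "poly (pderiv (\<Prod>w\<in>#proots P. [:-w, 1:])) z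
      = poly (\<Prod>w\<in>#proots P. [:-w, 1:]) z * (\<Sum>w\<in>#proots P. 1 / (z - w))"
    by blast
  have P: "P = smult (lead_coeff P) (\<Prod>w\<in>#proots P. [:-w, 1:])"
    by (rule complex_poly_decompose_multiset[symmetric])
  have "poly (pderiv P) z = poly P z * (\<Sum>w\<in>#proots P. 1 / (z - w))"
    by (subst (1 2) P) (simp add: pderiv_smult *)
  then show ?thesis using assms by simp
qed

text \<open>The argument principle for a polynomial and a rectangle.\<close>

lemma boundary_integral_logarithmic_derivative:
  fixes P :: "complex poly"
  assumes xy: "x0 < x1" "y0 < y1"
    and h: "\<And>x y. x \<in> {x0..x1} \<Longrightarrow> y \<in> {y0, y1} \<Longrightarrow> poly P (Complex x y) \<noteq> 0"
    and v: "\<And>x y. x \<in> {x0, x1} \<Longrightarrow> y \<in> {y0..y1} \<Longrightarrow> poly P (Complex x y) \<noteq> 0"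
  shows "boundary_integral (\<lambda>z. poly (pderiv P) z / poly P z) x0 x1 y0 y1 =
    2 * of_real pi * \<i> * of_nat (size {#w \<in># proots P. w \<in> box (Complex x0 y0) (Complex x1 y1)#})"
proof -
  have P: "P \<noteq> 0" using h[of x0 y0] xy by auto
  have im: "path_image (rectpath (Complex x0 y0) (Complex x1 y1)) =
     {z. Re z \<in> {x0, x1} \<and> Im z \<in> {y0..y1}} \<union> {z. Im z \<in> {y0, y1} \<and> Re z \<in> {x0..x1}}"
    using xy by (subst path_image_rectpath) auto
  have off: "poly P w \<noteq> 0" if "w \<in> path_image (rectpath (Complex x0 y0) (Complex x1 y1))" for w
    using that h[of "Re w" "Im w"] v[of "Re w" "Im w"] by (auto simp: im)
  have eq: "poly (pderiv P) (Complex x y) / poly P (Complex x y) = (\<Sum>w\<in>#proots P. 1 / (Complex x y - w))"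
    if "x \<in> {x0..x1} \<and> y \<in> {y0, y1} \<or> x \<in> {x0, x1} \<and> y \<in> {y0..y1}" for x y
    using that h v by (intro logarithmic_derivative_proots) blast
  have "boundary_integral (\<lambda>z. poly (pderiv P) z / poly P z) x0 x1 y0 y1
      = boundary_integral (\<lambda>z. \<Sum>w\<in>#proots P. 1 / (z - w)) x0 x1 y0 y1"
    unfolding boundary_integral_def
    by (intro arg_cong2[of _ _ _ _ "(-)"] arg_cong2[of _ _ _ _ "(+)"] arg_cong2[of _ _ _ _ "(*)"]
        set_lebesgue_integral_cong refl allI impI eq) auto
  also have "\<dots> = 2 * of_real pi * \<i> * of_nat (size {#w \<in># proots P. w \<in> box (Complex x0 y0) (Complex x1 y1)#})"
    using off P by (intro boundary_integral_sum_poles xy) auto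
  finally show ?thesis .
qed

text \<open>
  By scale invariance the integral \<open>J\<close> equals the integral over \<open>{0..1/2}\<close>, so \<open>J\<close> absorbs the positive
  integral over \<open>{1/2<..1}\<close> and is infinite.
\<close>

lemma nn_integral_inverse_0_1: "(\<integral>\<^sup>+s. indicator {0..1} s * inverse (ennreal s) \<partial>lborel) = \<infinity>"
proof -
  have meas [measurable]: "(\<lambda>s. indicator {0..1} s * inverse (ennreal s)) \<in> borel_measurable borel" by measurable
  define J where "J = (\<integral>\<^sup>+s. indicator {0..1} s * inverse (ennreal s) \<partial>lborel)"
  have "J = (\<integral>\<^sup>+s. indicator {0..1/2} s * inverse (ennreal s) + indicator {1/2<..1} s * inverse (ennreal s) \<partial>lborel)"
    unfolding J_def by (intro nn_integral_cong) (auto simp: indicator_def)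
  also have "\<dots> = (\<integral>\<^sup>+s. indicator {0..1/2} s * inverse (ennreal s) \<partial>lborel)
      + (\<integral>\<^sup>+s. indicator {1/2<..1} s * inverse (ennreal s) \<partial>lborel)"
    by (rule nn_integral_add) measurable
  also have "(\<integral>\<^sup>+s. indicator {0..1/2} s * inverse (ennreal s) \<partial>lborel)
      = ennreal \<bar>1/2\<bar> * (\<integral>\<^sup>+s. indicator {0..1/2} (0 + 1/2 * s) * inverse (ennreal (0 + 1/2 * s)) \<partial>lborel)"
    by (rule nn_integral_real_affine) auto
  also have "\<dots> = (\<integral>\<^sup>+s. ennreal (1/2) * (indicator {0..1/2} (0 + 1/2 * s) * inverse (ennreal (0 + 1/2 * s))) \<partial>lborel)"
    by (subst nn_integral_cmult) auto
  also have "\<dots> = J"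
    unfolding J_def
  proof (rule nn_integral_cong)
    fix s :: real
    show "ennreal (1/2) * (indicator {0..1/2} (0 + 1/2 * s) * inverse (ennreal (0 + 1/2 * s)))
        = indicator {0..1} s * inverse (ennreal s)"
    proof (cases "s \<in> {0<..1}")
      case True
      have "ennreal (1/2) * inverse (ennreal (1/2 * s)) = ennreal (1/2) * ennreal (inverse (1/2 * s))"
        using True by (subst inverse_ennreal) auto
      also have "\<dots> = ennreal (1/2 * inverse (1/2 * s))"
        by (rule ennreal_mult'[symmetric]) simp
      also have "1/2 * inverse (1/2 * s) = inverse s" using True by (simp add: field_simps)
      also have "ennreal (inverse s) = inverse (ennreal s)" using True by (simp add: inverse_ennreal)
      finally show ?thesis using True by (simp add: indicator_def)
    next
      case False
      then show ?thesis by (cases "s = 0") (auto simp: indicator_def ennreal_mult_eq_top_iff)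
    qed
  qed
  finally have J: "J = J + (\<integral>\<^sup>+s. indicator {1/2<..1} s * inverse (ennreal s) \<partial>lborel)" .
  have "ennreal (1/2) = (\<integral>\<^sup>+s. indicator {1/2<..1::real} s \<partial>lborel)" by simp
  also have "\<dots> \<le> (\<integral>\<^sup>+s. indicator {1/2<..1} s * inverse (ennreal s) \<partial>lborel)"
  proof (rule nn_integral_mono)
    fix s :: real
    show "(indicator {1/2<..1} s :: ennreal) \<le> indicator {1/2<..1} s * inverse (ennreal s)"
      by (auto simp: indicator_def inverse_ennreal one_le_inverse_iff)
  qed
  finally have pos: "(\<integral>\<^sup>+s. indicator {1/2<..1} s * inverse (ennreal s) \<partial>lborel) \<noteq> (0 :: ennreal)" by auto
  have "J = \<infinity>"
  proof (rule ccontr)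
    assume "J \<noteq> \<infinity>"
    then have "J + 0 < J + (\<integral>\<^sup>+s. indicator {1/2<..1} s * inverse (ennreal s) \<partial>lborel)"
      using pos by (intro ennreal_add_left_cancel_less[THEN iffD2] conjI) (auto simp: zero_less_iff_neq_zero)
    with J show False by simp
  qed
  then show ?thesis by (simp add: J_def)
qed

text \<open>Along a line through a zero, \<open>1 / \<bar>P\<bar>\<close> has a nonintegrable singularity.\<close>

lemma nn_integral_inverse_poly_line:
  fixes P :: "complex poly" and u v :: complex
  assumes ab: "a < b" and t0: "t0 \<in> {a..b}" and root: "poly P (u + of_real t0 * v) = 0"
  shows "(\<integral>\<^sup>+t. indicator {a..b} t * inverse (ennreal (cmod (poly P (u + of_real t * v)))) \<partial>lborel) = \<infinity>"
proof -
  obtain Q where Q: "P = [:- (u + of_real t0 * v), 1:] * Q"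
    using root by (auto simp: poly_eq_0_iff_dvd elim: dvdE)
  have "compact ((\<lambda>t. v * poly Q (u + of_real t * v)) ` {a..b})"
    by (intro compact_continuous_image continuous_intros) auto
  then have "bounded ((\<lambda>t. v * poly Q (u + of_real t * v)) ` {a..b})"
    by (rule compact_imp_bounded)
  then obtain C where C: "C > 0" "\<And>t. t \<in> {a..b} \<Longrightarrow> cmod (v * poly Q (u + of_real t * v)) \<le> C"
    unfolding bounded_pos by blast
  have le: "cmod (poly P (u + of_real t * v)) \<le> C * \<bar>t - t0\<bar>" if "t \<in> {a..b}" for t
  proof -
    have "poly P (u + of_real t * v) = of_real (t - t0) * (v * poly Q (u + of_real t * v))"
      unfolding Q by (simp add: algebra_simps)
    then have "cmod (poly P (u + of_real t * v)) = \<bar>t - t0\<bar> * cmod (v * poly Q (u + of_real t * v))"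
      by (simp only: norm_mult norm_of_real)
    also have "\<dots> \<le> \<bar>t - t0\<bar> * C" by (intro mult_left_mono C(2) that) auto
    finally show ?thesis by (simp only: mult.commute)
  qed
  have meas [measurable]: "(\<lambda>t. poly P (u + of_real t * v)) \<in> borel_measurable borel"
    "(\<lambda>s. poly P (u + of_real (t0 + e * s) * v)) \<in> borel_measurable borel" for e
    by (intro borel_measurable_continuous_onI continuous_intros)+
  \<comment> \<open>an endpoint on the side of \<open>t0\<close> where the interval does not degenerate\<close>
  obtain e where e: "e \<noteq> 0" "\<And>s. s \<in> {0..1} \<Longrightarrow> t0 + e * s \<in> {a..b}"
  proof (cases "t0 < b")
    case True
    have "t0 + (b - t0) * s \<in> {a..b}" if "s \<in> {0..1}" for s
    proof -
      have "(b - t0) * s \<le> b - t0" using that True by (intro mult_left_le) auto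
      moreover have "0 \<le> (b - t0) * s" using that True by simp
      ultimately show ?thesis using t0 by simp
    qed
    with True show ?thesis using that[of "b - t0"] by auto
  next
    case False
    then have "t0 = b" using t0 by simp
    have "t0 + (a - b) * s \<in> {a..b}" if "s \<in> {0..1}" for s
    proof -
      have "(b - a) * s \<le> b - a" using that ab by (intro mult_left_le) auto
      moreover have "0 \<le> (b - a) * s" using that ab by simp
      ultimately show ?thesis unfolding \<open>t0 = b\<close> by (simp add: algebra_simps)
    qed
    then show ?thesis using that[of "a - b"] ab by auto
  qed
  have "\<infinity> = ennreal (1 / C) * (\<integral>\<^sup>+s. indicator {0..1} s * inverse (ennreal s) \<partial>lborel)"
    using C(1) by (simp add: nn_integral_inverse_0_1 ennreal_mult_eq_top_iff)
  also have "\<dots> = (\<integral>\<^sup>+s. ennreal (1 / C) * (indicator {0..1} s * inverse (ennreal s)) \<partial>lborel)"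
    by (rule nn_integral_cmult[symmetric]) simp
  also have "\<dots> \<le> (\<integral>\<^sup>+s. ennreal \<bar>e\<bar> * (indicator {a..b} (t0 + e * s) *
      inverse (ennreal (cmod (poly P (u + of_real (t0 + e * s) * v))))) \<partial>lborel)"
  proof (rule nn_integral_mono)
    fix s :: real
    show "ennreal (1 / C) * (indicator {0..1} s * inverse (ennreal s)) \<le> ennreal \<bar>e\<bar> * (indicator {a..b} (t0 + e * s) *
      inverse (ennreal (cmod (poly P (u + of_real (t0 + e * s) * v)))))"
    proof (cases "s \<in> {0..1}")
      case s: True
      have m1: "inverse (ennreal (C * \<bar>e * s\<bar>)) \<le> inverse (ennreal (cmod (poly P (u + of_real (t0 + e * s) * v))))"
      proof (cases "poly P (u + of_real (t0 + e * s) * v) = 0")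
        case False
        then have N: "0 < cmod (poly P (u + of_real (t0 + e * s) * v))" by simp
        have *: "cmod (poly P (u + of_real (t0 + e * s) * v)) \<le> C * \<bar>e * s\<bar>"
          using le[OF e(2)[OF s]] by simp
        show ?thesis
          unfolding inverse_ennreal[OF N] inverse_ennreal[OF order_less_le_trans[OF N *]]
          by (intro ennreal_leI le_imp_inverse_le N *)
      qed simp
      have m2: "ennreal (1 / C) * inverse (ennreal s) \<le> ennreal \<bar>e\<bar> * inverse (ennreal (C * \<bar>e * s\<bar>))"
        using C(1) e(1) s
        by (cases "s = 0") (auto simp: inverse_ennreal ennreal_mult'[symmetric] abs_mult field_simps ennreal_mult_eq_top_iff ennreal_mult_top)
      show ?thesis
        using s e(2)[OF s] order_trans[OF m2 mult_left_mono[OF m1]] by simp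
    qed simp
  qed
  also have "\<dots> = ennreal \<bar>e\<bar> * (\<integral>\<^sup>+s. indicator {a..b} (t0 + e * s) *
      inverse (ennreal (cmod (poly P (u + of_real (t0 + e * s) * v)))) \<partial>lborel)"
    by (rule nn_integral_cmult) measurable
  also have "\<dots> = (\<integral>\<^sup>+t. indicator {a..b} t * inverse (ennreal (cmod (poly P (u + of_real t * v)))) \<partial>lborel)"
    by (rule nn_integral_real_affine[symmetric]) (use e(1) in measurable)
  finally show ?thesis by (simp add: top.extremum_unique)
qed

section \<open>Green's formula for a rectangle\<close>

lemma set_integral_cbox_complex:
  fixes G :: "complex \<Rightarrow> complex"
  assumes cont: "continuous_on UNIV G"
  shows "(LINT z:cbox (Complex x0 y0) (Complex x1 y1)|lborel. G z) =
      (LBINT x:{x0..x1}. LBINT y:{y0..y1}. G (Complex x y))" (is "?C = ?XY")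
    and "(LINT z:cbox (Complex x0 y0) (Complex x1 y1)|lborel. G z) =
      (LBINT y:{y0..y1}. LBINT x:{x0..x1}. G (Complex x y))" (is "_ = ?YX")
proof -
  define g where "g x y = indicat_real {x0..x1} x *\<^sub>R indicat_real {y0..y1} y *\<^sub>R G (Complex x y)" for x y
  define R where "R = cbox (Complex x0 y0) (Complex x1 y1)"
  have [measurable]: "G \<in> borel_measurable borel" using cont by (rule borel_measurable_continuous_onI)
  have g: "indicat_real R (case w of (x, y) \<Rightarrow> Complex x y) *\<^sub>R G (case w of (x, y) \<Rightarrow> Complex x y) = case_prod g w" for w
    by (cases w) (auto simp: g_def R_def indicator_def in_cbox_complex_iff)
  have "integrable lborel (\<lambda>z. indicat_real R z *\<^sub>R G z)"
    unfolding R_def by (intro borel_integrable_compact continuous_on_subset[OF cont]) auto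
  moreover have meas: "(\<lambda>(x, y). Complex x y) \<in> lborel \<Otimes>\<^sub>M lborel \<rightarrow>\<^sub>M borel"
    "(\<lambda>z. indicat_real R z *\<^sub>R G z) \<in> borel_measurable borel"
    unfolding R_def by measurable
  ultimately have int: "integrable (lborel \<Otimes>\<^sub>M lborel) (case_prod g)"
    by (subst (asm) lborel_complex, subst (asm) integrable_distr_eq) (auto simp: g cong: integrable_cong)
  have "?C = (\<integral>z. indicat_real R z *\<^sub>R G z \<partial>distr (lborel \<Otimes>\<^sub>M lborel) borel (\<lambda>(x, y). Complex x y))"
    unfolding set_lebesgue_integral_def R_def by (subst lborel_complex) (rule refl)
  also have "\<dots> = (\<integral>w. case_prod g w \<partial>(lborel \<Otimes>\<^sub>M lborel))"
    by (subst integral_distr[OF meas]) (simp add: g)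
  finally have C: "?C = (\<integral>w. case_prod g w \<partial>(lborel \<Otimes>\<^sub>M lborel))" .
  show "?C = ?XY"
    unfolding C lborel_pair.integral_fst[OF int, symmetric]
    unfolding g_def set_lebesgue_integral_def by (simp del: scaleR_scaleR)
  have "?C = (\<integral>y. \<integral>x. g x y \<partial>lborel \<partial>lborel)"
    unfolding C lborel_pair.integral_snd[OF int] ..
  also have "\<dots> = ?YX"
    unfolding g_def set_lebesgue_integral_def
    by (simp add: scaleR_scaleR mult.commute flip: integral_scaleR_right)
  finally show "?C = ?YX" .
qed

text \<open>
  On each pair of opposite sides the difference of \<open>F\<close> is an integral of a partial derivative.
\<close>

lemma boundary_integral_green:
  fixes F :: "complex \<Rightarrow> complex"
  assumes xy: "x0 \<le> x1" "y0 \<le> y1"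
    and Fx: "\<And>x y. ((\<lambda>x. F (Complex x y)) has_vector_derivative Fx (Complex x y)) (at x)"
    and Fy: "\<And>x y. ((\<lambda>y. F (Complex x y)) has_vector_derivative Fy (Complex x y)) (at y)"
    and cont: "continuous_on UNIV F" "continuous_on UNIV Fx" "continuous_on UNIV Fy"
  shows "boundary_integral F x0 x1 y0 y1 =
    (LINT z:cbox (Complex x0 y0) (Complex x1 y1)|lborel. \<i> * Fx z - Fy z)"
proof -
  have line: "continuous_on S (\<lambda>x. G (Complex x y))" "continuous_on S (\<lambda>y. G (Complex x y))"
    if "continuous_on UNIV G" for G :: "complex \<Rightarrow> complex" and S x y
    by (auto intro!: continuous_on_compose2[OF that] continuous_intros simp: Complex_eq)
  have int: "set_integrable lborel {a..b} (\<lambda>x. F (Complex x y))" "set_integrable lborel {a..b} (\<lambda>y. F (Complex x y))"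
    for a b x y
    by (intro borel_integrable_atLeastAtMost' line cont)+
  have x: "(LBINT x:{x0..x1}. Fx (Complex x y)) = F (Complex x1 y) - F (Complex x0 y)" for y
    unfolding set_lebesgue_integral_def using xy(1)
    by (rule integral_FTC_Icc) (auto intro!: has_vector_derivative_at_within[OF Fx] line cont)
  have y: "(LBINT y:{y0..y1}. Fy (Complex x y)) = F (Complex x y1) - F (Complex x y0)" for x
    unfolding set_lebesgue_integral_def using xy(2)
    by (rule integral_FTC_Icc) (auto intro!: has_vector_derivative_at_within[OF Fy] line cont)
  have int_box: "set_integrable lborel (cbox (Complex x0 y0) (Complex x1 y1)) G" if "continuous_on UNIV G" for G :: "complex \<Rightarrow> complex"
    unfolding set_integrable_def by (intro borel_integrable_compact continuous_on_subset[OF that]) auto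
  have "(LINT z:cbox (Complex x0 y0) (Complex x1 y1)|lborel. \<i> * Fx z - Fy z)
      = \<i> * (LINT z:cbox (Complex x0 y0) (Complex x1 y1)|lborel. Fx z) -
        (LINT z:cbox (Complex x0 y0) (Complex x1 y1)|lborel. Fy z)"
    using int_box cont by (simp add: set_integral_diff set_integral_mult_right)
  also have "\<dots> = \<i> * (LBINT y:{y0..y1}. F (Complex x1 y) - F (Complex x0 y))
      - (LBINT x:{x0..x1}. F (Complex x y1) - F (Complex x y0))"
    using cont by (simp add: set_integral_cbox_complex(2)[of Fx] set_integral_cbox_complex(1)[of Fy] x y)
  also have "\<dots> = boundary_integral F x0 x1 y0 y1"
    unfolding boundary_integral_def using int by (simp add: set_integral_diff algebra_simps)
  finally show ?thesis ..
qed

section \<open>The zeros of a Gaussian polynomial\<close>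

lemma Cauchy_Schwarz_sum_cnj:
  fixes f g :: "'i \<Rightarrow> complex"
  shows "(cmod (\<Sum>i\<in>I. f i * cnj (g i)))\<^sup>2 \<le> (\<Sum>i\<in>I. (cmod (f i))\<^sup>2) * (\<Sum>i\<in>I. (cmod (g i))\<^sup>2)"
proof -
  have "cmod (\<Sum>i\<in>I. f i * cnj (g i)) \<le> (\<Sum>i\<in>I. cmod (f i) * cmod (g i))"
    by (rule order_trans[OF norm_sum]) (simp add: norm_mult)
  then have "(cmod (\<Sum>i\<in>I. f i * cnj (g i)))\<^sup>2 \<le> (\<Sum>i\<in>I. cmod (f i) * cmod (g i))\<^sup>2"
    by (intro power_mono) auto
  also have "\<dots> \<le> (\<Sum>i\<in>I. (cmod (f i))\<^sup>2) * (\<Sum>i\<in>I. (cmod (g i))\<^sup>2)"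
    by (rule Cauchy_Schwarz_ineq_sum)
  finally show ?thesis .
qed

text \<open>
  The intensity formula holds for Gaussian combinations of arbitrary polynomials without a common zero;
  this condition is what keeps the kernel \<open>\<Sum>\<^sub>i \<bar>q\<^sub>i(z)\<bar>\<^sup>2\<close> positive.
\<close>

locale gaussian_polynomial = complex_gaussian_family +
  fixes q :: "'b \<Rightarrow> complex poly"
  assumes no_common_zero: "\<And>z. \<exists>i\<in>I. poly (q i) z \<noteq> 0"
begin

definition rpoly :: "'a \<Rightarrow> complex poly" where
  "rpoly \<omega> = (\<Sum>i\<in>I. smult (\<eta> i \<omega>) (q i))"

text \<open>
  With \<open>K(z, w) = \<Sum>\<^sub>i q\<^sub>i(z) cnj (q\<^sub>i(w))\<close>, these are the values at \<open>w = z\<close> of \<open>K\<close>, of its derivative in \<open>z\<close>,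
  and of its mixed derivative in \<open>z\<close> and \<open>cnj w\<close>.
\<close>

definition kernel :: "complex \<Rightarrow> real" where
  "kernel z = (\<Sum>i\<in>I. (cmod (poly (q i) z))\<^sup>2)"

definition kernel10 :: "complex \<Rightarrow> complex" where
  "kernel10 z = (\<Sum>i\<in>I. poly (pderiv (q i)) z * cnj (poly (q i) z))"

definition kernel11 :: "complex \<Rightarrow> real" where
  "kernel11 z = (\<Sum>i\<in>I. (cmod (poly (pderiv (q i)) z))\<^sup>2)"

definition density_of_zeros :: "complex \<Rightarrow> real" where
  "density_of_zeros z = (kernel11 z * kernel z - (cmod (kernel10 z))\<^sup>2) / (pi * (kernel z)\<^sup>2)"

definition log_deriv :: "'a \<Rightarrow> complex \<Rightarrow> complex" where
  "log_deriv \<omega> z = poly (pderiv (rpoly \<omega>)) z / poly (rpoly \<omega>) z"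

lemma poly_rpoly: "poly (rpoly \<omega>) z = (\<Sum>i\<in>I. poly (q i) z * \<eta> i \<omega>)"
  by (simp add: rpoly_def poly_sum mult.commute)

lemma poly_pderiv_rpoly: "poly (pderiv (rpoly \<omega>)) z = (\<Sum>i\<in>I. poly (pderiv (q i)) z * \<eta> i \<omega>)"
  by (simp add: rpoly_def poly_sum higher_pderiv_sum[of 1, simplified] pderiv_smult mult.commute)

lemma kernel_pos: "kernel z > 0"
proof -
  obtain i where "i \<in> I" "poly (q i) z \<noteq> 0" using no_common_zero by blast
  then show ?thesis unfolding kernel_def using finite_I by (intro sum_pos2[of I i]) auto
qed

lemma density_of_zeros_nonneg: "density_of_zeros z \<ge> 0"
  unfolding density_of_zeros_def kernel_def kernel11_def kernel10_def
  using Cauchy_Schwarz_sum_cnj[of "\<lambda>i. poly (pderiv (q i)) z" "\<lambda>i. poly (q i) z" I]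
  by (intro divide_nonneg_nonneg) auto

lemma continuous_kernel [continuous_intros]: "continuous_on S kernel"
  unfolding kernel_def[abs_def] by (intro continuous_intros)

lemma continuous_kernel10 [continuous_intros]: "continuous_on S kernel10"
  unfolding kernel10_def[abs_def] by (intro continuous_intros)

lemma continuous_density_of_zeros: "continuous_on S density_of_zeros"
  unfolding density_of_zeros_def[abs_def] kernel11_def
  using kernel_pos by (intro continuous_intros) (auto simp: less_le)

lemma expectation_log_deriv:
  "integrable M (\<lambda>\<omega>. log_deriv \<omega> z)"
  "expectation (\<lambda>\<omega>. log_deriv \<omega> z) = kernel10 z / of_real (kernel z)"
  "expectation (\<lambda>\<omega>. cmod (log_deriv \<omega> z)) \<le> (\<Sum>j\<in>I. cmod (poly (pderiv (q j)) z)) * ratio_bound / sqrt (kernel z)"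
  unfolding log_deriv_def poly_rpoly poly_pderiv_rpoly kernel10_def kernel_def
  by (rule expectation_quotient; use kernel_pos in \<open>simp add: kernel_def\<close>)+

lemma measurable_poly_rpoly [measurable]:
  assumes [measurable]: "\<gamma> \<in> borel_measurable N" "g \<in> N \<rightarrow>\<^sub>M M"
  shows "(\<lambda>w. poly (rpoly (g w)) (\<gamma> w)) \<in> borel_measurable N"
    and "(\<lambda>w. poly (pderiv (rpoly (g w))) (\<gamma> w)) \<in> borel_measurable N"
proof -
  have [measurable]: "(\<lambda>w. poly r (\<gamma> w)) \<in> borel_measurable N" for r
    using assms(1) by (rule measurable_compose) (intro borel_measurable_continuous_onI continuous_intros)
  show "(\<lambda>w. poly (rpoly (g w)) (\<gamma> w)) \<in> borel_measurable N"
    "(\<lambda>w. poly (pderiv (rpoly (g w))) (\<gamma> w)) \<in> borel_measurable N"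
    unfolding poly_rpoly poly_pderiv_rpoly by measurable
qed

text \<open>
  Fubini applies because the mean of \<open>\<bar>log_deriv\<bar>\<close> at a point is bounded by a continuous function of the
  point.
\<close>

lemma side_integral:
  fixes \<gamma> :: "real \<Rightarrow> complex"
  assumes cont: "continuous_on UNIV \<gamma>"
  shows "integrable M (\<lambda>\<omega>. LBINT t:{a..b}. log_deriv \<omega> (\<gamma> t))"
    and "expectation (\<lambda>\<omega>. LBINT t:{a..b}. log_deriv \<omega> (\<gamma> t)) = (LBINT t:{a..b}. kernel10 (\<gamma> t) / of_real (kernel (\<gamma> t)))"
proof -
  interpret Q: pair_sigma_finite lborel M ..
  have [measurable]: "\<gamma> \<in> borel_measurable borel" using cont by (rule borel_measurable_continuous_onI)
  define f where "f t \<omega> = indicat_real {a..b} t *\<^sub>R log_deriv \<omega> (\<gamma> t)" for t \<omega>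
  have meas [measurable]: "case_prod f \<in> borel_measurable (lborel \<Otimes>\<^sub>M M)"
    unfolding f_def log_deriv_def split_beta' by measurable
  define B where "B z = (\<Sum>j\<in>I. cmod (poly (pderiv (q j)) z)) * ratio_bound / sqrt (kernel z)" for z
  have contB: "continuous_on {a..b} (\<lambda>t. B (\<gamma> t))"
  proof (rule continuous_on_compose2[of UNIV B])
    show "continuous_on UNIV B"
      unfolding B_def using kernel_pos by (intro continuous_intros) (auto simp: less_le)
    show "continuous_on {a..b} \<gamma>" using cont continuous_on_subset by blast
  qed auto
  have int: "integrable (lborel \<Otimes>\<^sub>M M) (case_prod f)"
  proof (rule Q.Fubini_integrable)
    show "AE t in lborel. integrable M (\<lambda>\<omega>. case (t, \<omega>) of (t, \<omega>) \<Rightarrow> f t \<omega>)"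
      by (simp add: f_def expectation_log_deriv)
    show "integrable lborel (\<lambda>t. \<integral>\<omega>. norm (case (t, \<omega>) of (t, \<omega>) \<Rightarrow> f t \<omega>) \<partial>M)"
    proof (rule Bochner_Integration.integrable_bound)
      show "integrable lborel (\<lambda>t. indicat_real {a..b} t *\<^sub>R B (\<gamma> t))"
        using borel_integrable_atLeastAtMost'[OF contB] by (simp add: set_integrable_def)
      show "AE t in lborel. norm (\<integral>\<omega>. norm (case (t, \<omega>) of (t, \<omega>) \<Rightarrow> f t \<omega>) \<partial>M)
          \<le> norm (indicat_real {a..b} t *\<^sub>R B (\<gamma> t))"
      proof (intro AE_I2)
        fix t
        have "expectation (\<lambda>\<omega>. cmod (log_deriv \<omega> (\<gamma> t))) \<le> B (\<gamma> t)" unfolding B_def by (rule expectation_log_deriv)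
        moreover have "expectation (\<lambda>\<omega>. cmod (log_deriv \<omega> (\<gamma> t))) \<ge> 0" by simp
        ultimately show "norm (\<integral>\<omega>. norm (case (t, \<omega>) of (t, \<omega>) \<Rightarrow> f t \<omega>) \<partial>M)
          \<le> norm (indicat_real {a..b} t *\<^sub>R B (\<gamma> t))"
          by (auto simp: f_def indicator_def)
      qed
    qed measurable
  qed (rule meas)
  show "integrable M (\<lambda>\<omega>. LBINT t:{a..b}. log_deriv \<omega> (\<gamma> t))"
    using Q.integrable_snd[OF int] by (simp add: f_def set_lebesgue_integral_def)
  have "expectation (\<lambda>\<omega>. LBINT t:{a..b}. log_deriv \<omega> (\<gamma> t)) = (\<integral>t. \<integral>\<omega>. f t \<omega> \<partial>M \<partial>lborel)"
    using Q.Fubini_integral[OF int] by (simp add: f_def set_lebesgue_integral_def)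
  also have "\<dots> = (LBINT t:{a..b}. kernel10 (\<gamma> t) / of_real (kernel (\<gamma> t)))"
    by (simp add: f_def set_lebesgue_integral_def expectation_log_deriv)
  finally show "expectation (\<lambda>\<omega>. LBINT t:{a..b}. log_deriv \<omega> (\<gamma> t)) = (LBINT t:{a..b}. kernel10 (\<gamma> t) / of_real (kernel (\<gamma> t)))" .
qed

text \<open>
  The mean of \<open>1 / \<bar>rpoly\<bar>\<close> is a continuous function of the point, so the integral of \<open>1 / \<bar>rpoly\<bar>\<close> along the
  segment is almost surely finite, whereas a zero on the segment would make it infinite. The zero
  polynomial is excluded as well.
\<close>

lemma AE_no_zero_on_segment:
  assumes ab: "a < b"
  shows "AE \<omega> in M. \<forall>t\<in>{a..b}. poly (rpoly \<omega>) (u + of_real t * v) \<noteq> 0"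
proof -
  interpret Q: pair_sigma_finite lborel M ..
  define \<gamma> where "\<gamma> t = u + of_real t * v" for t :: real
  have cont: "continuous_on S \<gamma>" for S unfolding \<gamma>_def by (intro continuous_intros)
  have [measurable]: "\<gamma> \<in> borel_measurable borel" using cont by (rule borel_measurable_continuous_onI)
  define f :: "real \<Rightarrow> 'a \<Rightarrow> ennreal" where
    "f t \<omega> = indicator {a..b} t * inverse (ennreal (cmod (poly (rpoly \<omega>) (\<gamma> t))))" for t \<omega>
  have meas [measurable]: "case_prod f \<in> borel_measurable (lborel \<Otimes>\<^sub>M M)"
    unfolding f_def split_beta' by measurable
  have [measurable]: "kernel \<in> borel_measurable borel"
    by (intro borel_measurable_continuous_onI continuous_kernel)
  define C where "C = (\<integral>\<^sup>+z. inverse (ennreal (cmod z)) \<partial>cgauss)"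
  have contK: "continuous_on {a..b} (\<lambda>t. 1 / sqrt (kernel (\<gamma> t)))"
  proof (rule continuous_on_compose2[of UNIV "\<lambda>z. 1 / sqrt (kernel z)"])
    show "continuous_on UNIV (\<lambda>z. 1 / sqrt (kernel z))"
      using kernel_pos by (intro continuous_intros) (auto simp: less_le)
  qed (auto intro: cont)
  have inner: "(\<integral>\<^sup>+\<omega>. f t \<omega> \<partial>M) = ennreal (norm (indicat_real {a..b} t *\<^sub>R (1 / sqrt (kernel (\<gamma> t))))) * C" for t
  proof (cases "t \<in> {a..b}")
    case True
    have "(\<integral>\<^sup>+\<omega>. f t \<omega> \<partial>M) = (\<integral>\<^sup>+\<omega>. inverse (ennreal (cmod (\<Sum>i\<in>I. poly (q i) (\<gamma> t) * \<eta> i \<omega>))) \<partial>M)"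
      using True by (simp add: f_def poly_rpoly)
    also have "\<dots> = ennreal (1 / sqrt (kernel (\<gamma> t))) * C"
      unfolding kernel_def C_def
      by (rule nn_integral_inverse_linear_combination) (use kernel_pos in \<open>simp add: kernel_def\<close>)
    finally show ?thesis using True kernel_pos[of "\<gamma> t"] by simp
  qed (simp add: f_def)
  have "(\<integral>\<^sup>+\<omega>. (\<integral>\<^sup>+t. f t \<omega> \<partial>lborel) \<partial>M) = (\<integral>\<^sup>+t. (\<integral>\<^sup>+\<omega>. f t \<omega> \<partial>M) \<partial>lborel)"
    by (rule Q.Fubini') measurable
  also have "\<dots> = (\<integral>\<^sup>+t. ennreal (norm (indicat_real {a..b} t *\<^sub>R (1 / sqrt (kernel (\<gamma> t))))) \<partial>lborel) * C"
    unfolding inner by (rule nn_integral_multc) measurable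
  also have "\<dots> < \<infinity>"
    using borel_integrable_atLeastAtMost'[OF contK] nn_integral_inverse_norm_cgauss_finite
    unfolding set_integrable_def integrable_iff_bounded C_def by (auto simp: ennreal_mult_less_top)
  finally have "(\<integral>\<^sup>+\<omega>. (\<integral>\<^sup>+t. f t \<omega> \<partial>lborel) \<partial>M) \<noteq> \<infinity>" by simp
  moreover have "(\<lambda>\<omega>. \<integral>\<^sup>+t. f t \<omega> \<partial>lborel) \<in> borel_measurable M"
    unfolding f_def by (intro lborel.borel_measurable_nn_integral) measurable
  ultimately have "AE \<omega> in M. (\<integral>\<^sup>+t. f t \<omega> \<partial>lborel) \<noteq> \<infinity>"
    by (intro nn_integral_PInf_AE)
  then show ?thesis
  proof eventually_elim
    case (elim \<omega>)
    show ?case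
    proof
      fix t assume t: "t \<in> {a..b}"
      show "poly (rpoly \<omega>) (u + of_real t * v) \<noteq> 0"
        using nn_integral_inverse_poly_line[OF ab t, of "rpoly \<omega>" u v] elim
        unfolding f_def \<gamma>_def by blast
    qed
  qed
qed

lemma AE_boundary_integral_counts:
  assumes xy: "x0 < x1" "y0 < y1"
  shows "AE \<omega> in M. boundary_integral (log_deriv \<omega>) x0 x1 y0 y1 =
    2 * of_real pi * \<i> * of_nat (size {#w \<in># proots (rpoly \<omega>). w \<in> box (Complex x0 y0) (Complex x1 y1)#})"
proof -
  have h: "AE \<omega> in M. \<forall>x\<in>{x0..x1}. poly (rpoly \<omega>) (\<i> * of_real y + of_real x * 1) \<noteq> 0" for y
    by (rule AE_no_zero_on_segment[OF xy(1)])
  have v: "AE \<omega> in M. \<forall>y\<in>{y0..y1}. poly (rpoly \<omega>) (of_real x + of_real y * \<i>) \<noteq> 0" for x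
    by (rule AE_no_zero_on_segment[OF xy(2)])
  from h[of y0] h[of y1] v[of x0] v[of x1] show ?thesis
  proof eventually_elim
    case (elim \<omega>)
    then have "boundary_integral (\<lambda>z. poly (pderiv (rpoly \<omega>)) z / poly (rpoly \<omega>) z) x0 x1 y0 y1 =
        2 * of_real pi * \<i> * of_nat (size {#w \<in># proots (rpoly \<omega>). w \<in> box (Complex x0 y0) (Complex x1 y1)#})"
      by (intro boundary_integral_logarithmic_derivative xy) (auto simp: Complex_eq add.commute mult.commute)
    then show ?case by (simp add: log_deriv_def[abs_def])
  qed
qed

lemma expectation_boundary_integral:
  shows "integrable M (\<lambda>\<omega>. boundary_integral (log_deriv \<omega>) x0 x1 y0 y1)"
    and "expectation (\<lambda>\<omega>. boundary_integral (log_deriv \<omega>) x0 x1 y0 y1)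
      = boundary_integral (\<lambda>z. kernel10 z / of_real (kernel z)) x0 x1 y0 y1"
proof -
  have c: "continuous_on UNIV (\<lambda>x. Complex x y)" "continuous_on UNIV (\<lambda>y. Complex x y)" for x y
    unfolding Complex_eq by (intro continuous_intros)+
  note side_integral[OF c(1)] side_integral[OF c(2)]
  then show "integrable M (\<lambda>\<omega>. boundary_integral (log_deriv \<omega>) x0 x1 y0 y1)"
    "expectation (\<lambda>\<omega>. boundary_integral (log_deriv \<omega>) x0 x1 y0 y1)
      = boundary_integral (\<lambda>z. kernel10 z / of_real (kernel z)) x0 x1 y0 y1"
    unfolding boundary_integral_def by simp_all
qed

lemma poly_vector_derivatives:
  "((\<lambda>x. poly r (Complex x y)) has_vector_derivative poly (pderiv r) (Complex x y)) (at x)"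
  "((\<lambda>y. poly r (Complex x y)) has_vector_derivative \<i> * poly (pderiv r) (Complex x y)) (at y)"
proof -
  have "((\<lambda>x. Complex x y) has_vector_derivative 1) (at x)"
    unfolding Complex_eq by (auto intro!: derivative_eq_intros)
  from field_vector_diff_chain_at[OF this poly_DERIV[of r "Complex x y"]]
  show "((\<lambda>x. poly r (Complex x y)) has_vector_derivative poly (pderiv r) (Complex x y)) (at x)"
    by (simp add: o_def)
  have "((\<lambda>y. Complex x y) has_vector_derivative \<i>) (at y)"
    unfolding Complex_eq by (auto intro!: derivative_eq_intros)
  from field_vector_diff_chain_at[OF this poly_DERIV[of r "Complex x y"]]
  show "((\<lambda>y. poly r (Complex x y)) has_vector_derivative \<i> * poly (pderiv r) (Complex x y)) (at y)"
    by (simp add: o_def)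
qed

lemma has_vector_derivative_quotient:
  fixes f g :: "real \<Rightarrow> complex"
  assumes "(f has_vector_derivative f') (at x)" "(g has_vector_derivative g') (at x)" "g x \<noteq> 0"
  shows "((\<lambda>x. f x / g x) has_vector_derivative (f' * g x - f x * g') / (g x)\<^sup>2) (at x)"
proof -
  have "(inverse has_field_derivative - (inverse (g x) ^ Suc (Suc 0))) (at (g x))"
    by (rule DERIV_inverse[OF assms(3)])
  from has_vector_derivative_mult[OF assms(1) field_vector_diff_chain_at[OF assms(2) this]]
  show ?thesis
    using assms(3) by (auto simp: o_def divide_inverse[symmetric] field_simps power2_eq_square
      elim!: has_vector_derivative_eq_rhs)
qed

text \<open>
  With \<open>K = \<Sum>\<^sub>i \<bar>q\<^sub>i\<bar>\<^sup>2\<close>, the integrand is \<open>\<partial>\<^sub>z log K\<close>, and Green's formula integrates \<open>2 \<i>\<close> times its derivative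
  in \<open>cnj z\<close>, which is \<open>\<pi>\<close> times the density: the terms \<open>A\<close> with second derivatives of the
  \<open>q\<^sub>i\<close> cancel in \<open>\<i> Fx - Fy\<close>.
\<close>

lemma boundary_integral_density:
  assumes xy: "x0 \<le> x1" "y0 \<le> y1"
  shows "boundary_integral (\<lambda>z. kernel10 z / of_real (kernel z)) x0 x1 y0 y1 =
    2 * of_real pi * \<i> * of_real (LINT z:cbox (Complex x0 y0) (Complex x1 y1)|lborel. density_of_zeros z)"
proof -
  define k where "k z = (\<Sum>i\<in>I. poly (q i) z * cnj (poly (q i) z))" for z
  define A where "A z = (\<Sum>i\<in>I. poly (pderiv (pderiv (q i))) z * cnj (poly (q i) z))" for z
  define B where "B z = (\<Sum>i\<in>I. poly (pderiv (q i)) z * cnj (poly (pderiv (q i)) z))" for z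
  define Fx where "Fx z = ((A z + B z) * k z - kernel10 z * (kernel10 z + cnj (kernel10 z))) / (k z)\<^sup>2" for z
  define Fy where "Fy z = ((\<i> * A z - \<i> * B z) * k z - kernel10 z * (\<i> * kernel10 z - \<i> * cnj (kernel10 z))) / (k z)\<^sup>2" for z
  have k: "k z = of_real (kernel z)" for z by (simp add: k_def kernel_def complex_norm_square[symmetric])
  have k0: "k z \<noteq> 0" for z using kernel_pos[of z] by (simp add: k)
  have B: "B z = of_real (kernel11 z)" for z by (simp add: B_def kernel11_def complex_norm_square[symmetric])
  have cL: "cnj (kernel10 z) = (\<Sum>i\<in>I. poly (q i) z * cnj (poly (pderiv (q i)) z))" for z
    by (simp add: kernel10_def mult.commute)
  have dLx: "((\<lambda>x. kernel10 (Complex x y)) has_vector_derivative A (Complex x y) + B (Complex x y)) (at x)" for x y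
    unfolding kernel10_def A_def B_def
    by (auto intro!: derivative_eq_intros poly_vector_derivatives simp: sum.distrib algebra_simps)
  have dLy: "((\<lambda>y. kernel10 (Complex x y)) has_vector_derivative \<i> * A (Complex x y) - \<i> * B (Complex x y)) (at y)" for x y
    unfolding kernel10_def A_def B_def
    by (auto intro!: derivative_eq_intros poly_vector_derivatives
        simp: sum.distrib sum_subtractf sum_distrib_left sum_negf algebra_simps)
  have dkx: "((\<lambda>x. k (Complex x y)) has_vector_derivative kernel10 (Complex x y) + cnj (kernel10 (Complex x y))) (at x)" for x y
    unfolding k_def cL kernel10_def
    by (auto intro!: derivative_eq_intros poly_vector_derivatives simp: sum.distrib algebra_simps)
  have dky: "((\<lambda>y. k (Complex x y)) has_vector_derivative \<i> * kernel10 (Complex x y) - \<i> * cnj (kernel10 (Complex x y))) (at y)" for x y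
    unfolding k_def cL kernel10_def
    by (auto intro!: derivative_eq_intros poly_vector_derivatives
        simp: sum.distrib sum_subtractf sum_distrib_left sum_negf algebra_simps)
  have cont: "continuous_on UNIV A" "continuous_on UNIV B" "continuous_on UNIV k"
    unfolding A_def B_def k_def by (intro continuous_intros)+
  have eq: "\<i> * Fx z - Fy z = 2 * of_real pi * \<i> * of_real (density_of_zeros z)" for z
  proof -
    have "\<i> * Fx z - Fy z = 2 * \<i> * (B z * k z - kernel10 z * cnj (kernel10 z)) / (k z)\<^sup>2"
      unfolding Fx_def Fy_def using k0[of z] by (simp add: field_simps)
    also have "\<dots> = 2 * \<i> * of_real ((kernel11 z * kernel z - (cmod (kernel10 z))\<^sup>2) / (kernel z)\<^sup>2)"
      by (simp add: B k flip: complex_norm_square)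
    finally show ?thesis by (simp add: density_of_zeros_def)
  qed
  have "boundary_integral (\<lambda>z. kernel10 z / of_real (kernel z)) x0 x1 y0 y1
      = boundary_integral (\<lambda>z. kernel10 z / k z) x0 x1 y0 y1"
    by (simp add: k)
  also have "\<dots> = (LINT z:cbox (Complex x0 y0) (Complex x1 y1)|lborel. \<i> * Fx z - Fy z)"
  proof (rule boundary_integral_green[OF xy])
    show "((\<lambda>x. kernel10 (Complex x y) / k (Complex x y)) has_vector_derivative Fx (Complex x y)) (at x)" for x y
      unfolding Fx_def by (intro has_vector_derivative_quotient dLx dkx k0)
    show "((\<lambda>y. kernel10 (Complex x y) / k (Complex x y)) has_vector_derivative Fy (Complex x y)) (at y)" for x y
      unfolding Fy_def by (intro has_vector_derivative_quotient dLy dky k0)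
    show "continuous_on UNIV (\<lambda>z. kernel10 z / k z)" "continuous_on UNIV Fx" "continuous_on UNIV Fy"
      unfolding Fx_def Fy_def using k0 by (auto intro!: continuous_intros cont)
  qed
  also have "\<dots> = (LINT z:cbox (Complex x0 y0) (Complex x1 y1)|lborel. 2 * of_real pi * \<i> * of_real (density_of_zeros z))"
    unfolding eq ..
  also have "\<dots> = 2 * of_real pi * \<i> * of_real (LINT z:cbox (Complex x0 y0) (Complex x1 y1)|lborel. density_of_zeros z)"
    unfolding set_integral_mult_right set_integral_complex_of_real ..
  finally show ?thesis .
qed

end

section \<open>From rectangles to Borel sets\<close>

definition zero_count :: "complex multiset \<Rightarrow> complex set \<Rightarrow> ennreal" where
  "zero_count m A = of_nat (size {#w \<in># m. w \<in> A#})"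

lemma zero_count_simps [simp]: "zero_count {#} A = 0" "zero_count (add_mset w m) A = indicator A w + zero_count m A"
  by (simp_all add: zero_count_def indicator_def)

lemma zero_count_Compl: "zero_count m (- A) = zero_count m UNIV - zero_count m A"
proof -
  have "zero_count m UNIV = zero_count m (- A) + zero_count m A"
    by (induction m) (auto simp: indicator_def add_ac)
  moreover have "zero_count m A \<noteq> \<infinity>" by (simp add: zero_count_def ennreal_of_nat_eq_real_of_nat)
  ultimately show ?thesis by (simp add: ennreal_add_diff_cancel_right)
qed

lemma zero_count_mono: "A \<subseteq> B \<Longrightarrow> zero_count m A \<le> zero_count m B"
  by (induction m) (auto intro: add_mono add_increasing simp: indicator_def)

lemma zero_count_UN_disjoint:
  assumes "disjoint_family A"
  shows "zero_count m (\<Union>i. A i) = (\<Sum>i. zero_count m (A i))"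
proof (induction m)
  case (add w m)
  then show ?case
    by (simp add: suminf_add[symmetric] suminf_indicator[OF assms])
qed simp

lemma zero_count_UN_incseq:
  assumes "incseq A"
  shows "zero_count m (\<Union>i. A i) = (SUP i. zero_count m (A i))"
proof (induction m)
  case (add w m)
  have "indicator (\<Union>i. A i) w = (SUP i. indicator (A i) w :: ennreal)"
  proof (cases "w \<in> (\<Union>i. A i)")
    case True
    then obtain k where "w \<in> A k" by blast
    then have 1: "1 \<le> (SUP i. indicator (A i) w :: ennreal)" by (intro SUP_upper2[of k]) auto
    have 2: "(SUP i. indicator (A i) w :: ennreal) \<le> 1" by (intro SUP_least) (auto simp: indicator_def)
    show ?thesis using True antisym[OF 2 1] by simp
  qed auto
  moreover have "incseq (\<lambda>i. indicator (A i) w :: ennreal)" "incseq (\<lambda>i. zero_count m (A i))"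
    using assms by (auto simp: incseq_def indicator_def intro!: zero_count_mono)
  ultimately show ?case
    by (simp add: add ennreal_SUP_add)
qed simp

context gaussian_polynomial
begin

text \<open>
  Almost surely the count is the boundary integral of \<open>log_deriv\<close> over \<open>2 \<pi> \<i>\<close>, and the latter is a
  measurable function of \<open>\<omega>\<close> with known mean.
\<close>

lemma expected_zeros_box:
  "\<exists>g\<in>borel_measurable M. (AE \<omega> in M. zero_count (proots (rpoly \<omega>)) (box a b) = g \<omega>) \<and>
    (\<integral>\<^sup>+\<omega>. g \<omega> \<partial>M) = emeasure (density lborel (\<lambda>z. ennreal (density_of_zeros z))) (box a b)"
proof (cases "Re a < Re b \<and> Im a < Im b")
  case False
  then have "box a b = {}" by (auto simp: box_complex_eq)
  then show ?thesis by (intro bexI[of _ "\<lambda>_. 0"]) (auto simp: zero_count_def)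
next
  case True
  define x0 x1 y0 y1 where "x0 = Re a" and "x1 = Re b" and "y0 = Im a" and "y1 = Im b"
  have xy: "x0 < x1" "y0 < y1" and ab: "a = Complex x0 y0" "b = Complex x1 y1"
    using True by (simp_all add: x0_def x1_def y0_def y1_def)
  define Z where "Z \<omega> = Re (boundary_integral (log_deriv \<omega>) x0 x1 y0 y1 / (2 * of_real pi * \<i>))" for \<omega>
  have intZ: "integrable M Z"
    unfolding Z_def using expectation_boundary_integral(1) by auto
  have cont: "continuous_on UNIV density_of_zeros" by (rule continuous_density_of_zeros)
  have [measurable]: "density_of_zeros \<in> borel_measurable borel"
    using cont by (rule borel_measurable_continuous_onI)
  have EZ: "expectation Z = (LINT z:cbox a b|lborel. density_of_zeros z)"
  proof -
    have "expectation Z = Re (expectation (\<lambda>\<omega>. boundary_integral (log_deriv \<omega>) x0 x1 y0 y1 / (2 * of_real pi * \<i>)))"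
      unfolding Z_def using expectation_boundary_integral(1) by (intro integral_Re) auto
    also have "expectation (\<lambda>\<omega>. boundary_integral (log_deriv \<omega>) x0 x1 y0 y1 / (2 * of_real pi * \<i>))
        = of_real (LINT z:cbox a b|lborel. density_of_zeros z)"
      using boundary_integral_density[of x0 x1 y0 y1] xy
      by (simp add: expectation_boundary_integral ab)
    finally show ?thesis by simp
  qed
  have AE: "AE \<omega> in M. zero_count (proots (rpoly \<omega>)) (box a b) = ennreal (Z \<omega>) \<and> 0 \<le> Z \<omega>"
    using AE_boundary_integral_counts[OF xy]
  proof eventually_elim
    case (elim \<omega>)
    have "Z \<omega> = real (size {#w \<in># proots (rpoly \<omega>). w \<in> box a b#})"
      unfolding Z_def elim ab by simp
    then show ?case by (simp add: zero_count_def ennreal_of_nat_eq_real_of_nat)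
  qed
  have "(\<integral>\<^sup>+\<omega>. ennreal (Z \<omega>) \<partial>M) = ennreal (LINT z:cbox a b|lborel. density_of_zeros z)"
    using AE intZ by (subst nn_integral_eq_integral) (auto simp: EZ)
  also have "\<dots> = (\<integral>\<^sup>+z. ennreal (indicat_real (cbox a b) z *\<^sub>R density_of_zeros z) \<partial>lborel)"
    unfolding set_lebesgue_integral_def
    using borel_integrable_compact[OF compact_cbox continuous_on_subset[OF cont], of a b] density_of_zeros_nonneg
    by (intro nn_integral_eq_integral[symmetric]) auto
  also have "\<dots> = (\<integral>\<^sup>+z. ennreal (density_of_zeros z) * indicator (box a b) z \<partial>lborel)"
  proof (rule nn_integral_cong_AE)
    have "AE z in lborel. z \<notin> cbox a b - box a b"
      by (rule AE_not_in[OF null_sets_cbox_Diff_box])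
    then show "AE z in lborel. ennreal (indicat_real (cbox a b) z *\<^sub>R density_of_zeros z)
        = ennreal (density_of_zeros z) * indicator (box a b) z"
      by eventually_elim (use box_subset_cbox[of a b] in \<open>auto simp: indicator_def\<close>)
  qed
  also have "\<dots> = emeasure (density lborel (\<lambda>z. ennreal (density_of_zeros z))) (box a b)"
    by (subst emeasure_density) auto
  finally show ?thesis
    using AE intZ by (intro bexI[of _ "\<lambda>\<omega>. ennreal (Z \<omega>)"]) auto
qed

lemma zero_count_rpoly_le: "zero_count (proots (rpoly \<omega>)) A \<le> of_nat (\<Sum>i\<in>I. degree (q i))"
proof -
  have "degree (rpoly \<omega>) \<le> (\<Sum>i\<in>I. degree (q i))"
    unfolding rpoly_def
  proof (rule degree_sum_le[OF finite_I])
    fix i assume i: "i \<in> I"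
    have "degree (smult (\<eta> i \<omega>) (q i)) \<le> degree (q i)" by (rule degree_smult_le)
    also have "\<dots> \<le> (\<Sum>i\<in>I. degree (q i))" using i finite_I by (intro member_le_sum) auto
    finally show "degree (smult (\<eta> i \<omega>) (q i)) \<le> (\<Sum>i\<in>I. degree (q i))" .
  qed
  then have "size {#w \<in># proots (rpoly \<omega>). w \<in> A#} \<le> (\<Sum>i\<in>I. degree (q i))"
    using size_filter_mset_lesseq[of "\<lambda>w. w \<in> A" "proots (rpoly \<omega>)"] size_proots_le[of "rpoly \<omega>"] by linarith
  then show ?thesis unfolding zero_count_def by (rule of_nat_mono)
qed

text \<open>
  Boxes form an intersection-stable generator of the Borel sets, and both sides are finite measures in
  \<open>A\<close>. For boxes the count is only known to agree almost surely with a measurable function, so the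
  induction carries for each set a measurable version of its count.
\<close>

theorem expected_zeros:
  assumes "A \<in> sets borel"
  shows "(\<integral>\<^sup>+\<omega>. zero_count (proots (rpoly \<omega>)) A \<partial>M) = (\<integral>\<^sup>+z\<in>A. ennreal (density_of_zeros z) \<partial>lborel)"
proof -
  define \<nu> where "\<nu> = density lborel (\<lambda>z. ennreal (density_of_zeros z))"
  have [measurable]: "density_of_zeros \<in> borel_measurable borel"
    using continuous_density_of_zeros by (rule borel_measurable_continuous_onI)
  have sets_\<nu> [simp]: "sets \<nu> = sets borel" and space_\<nu> [simp]: "space \<nu> = UNIV" by (simp_all add: \<nu>_def)
  define N where "N A \<omega> = zero_count (proots (rpoly \<omega>)) A" for A \<omega>
  define good where "good A \<longleftrightarrow> (\<exists>g\<in>borel_measurable M. (AE \<omega> in M. N A \<omega> = g \<omega>) \<and> (\<integral>\<^sup>+\<omega>. g \<omega> \<partial>M) = emeasure \<nu> A)" for A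
  have good_box: "good (box a b)" for a b
    unfolding good_def N_def \<nu>_def by (rule expected_zeros_box)
  define B where "B k = box (Complex (- real k) (- real k)) (Complex (real k) (real k))" for k
  have incB: "incseq B"
    unfolding B_def incseq_def by (auto simp: box_complex_eq)
  have UB: "(\<Union>k. B k) = UNIV"
  proof -
    have "z \<in> (\<Union>k. B k)" for z
    proof -
      obtain k where "cmod z < real k" using reals_Archimedean2 by blast
      then have "z \<in> B k"
        using abs_Re_le_cmod[of z] abs_Im_le_cmod[of z] by (auto simp: B_def box_complex_eq abs_le_iff)
      then show ?thesis by blast
    qed
    then show ?thesis by auto
  qed
  have good_UNIV: "good UNIV"
  proof -
    have "\<forall>k. \<exists>g\<in>borel_measurable M. (AE \<omega> in M. N (B k) \<omega> = g \<omega>) \<and> (\<integral>\<^sup>+\<omega>. g \<omega> \<partial>M) = emeasure \<nu> (B k)"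
      using good_box unfolding good_def B_def by blast
    then obtain g where g [measurable]: "\<And>k. g k \<in> borel_measurable M"
      and ae: "\<And>k. AE \<omega> in M. N (B k) \<omega> = g k \<omega>" and ig: "\<And>k. (\<integral>\<^sup>+\<omega>. g k \<omega> \<partial>M) = emeasure \<nu> (B k)"
      by metis
    have ae': "AE \<omega> in M. \<forall>k. N (B k) \<omega> = g k \<omega>" using ae by (simp add: AE_all_countable)
    have "AE \<omega> in M. N UNIV \<omega> = (SUP k. g k \<omega>)"
      using ae' by eventually_elim (simp add: N_def UB[symmetric] zero_count_UN_incseq[OF incB])
    moreover have "(\<integral>\<^sup>+\<omega>. (SUP k. g k \<omega>) \<partial>M) = (SUP k. \<integral>\<^sup>+\<omega>. g k \<omega> \<partial>M)"
    proof (rule nn_integral_monotone_convergence_SUP_AE)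
      fix k
      show "AE \<omega> in M. g k \<omega> \<le> g (Suc k) \<omega>"
        using ae'
      proof eventually_elim
        case (elim \<omega>)
        then show ?case using zero_count_mono[OF incseq_SucD[OF incB, of k]] by (simp add: N_def flip: elim)
      qed
    qed measurable
    moreover have "(SUP k. \<integral>\<^sup>+\<omega>. g k \<omega> \<partial>M) = emeasure \<nu> UNIV"
    proof -
      have "range B \<subseteq> sets \<nu>" by (auto simp: B_def)
      then show ?thesis unfolding ig UB[symmetric] by (rule SUP_emeasure_incseq[OF _ incB])
    qed
    ultimately show ?thesis
      unfolding good_def by (intro bexI[of _ "\<lambda>\<omega>. SUP k. g k \<omega>"]) auto
  qed
  have finite_good: "emeasure \<nu> A < \<infinity>" if "good A" for A
  proof -
    obtain g where g: "AE \<omega> in M. N A \<omega> = g \<omega>" "(\<integral>\<^sup>+\<omega>. g \<omega> \<partial>M) = emeasure \<nu> A"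
      using \<open>good A\<close> unfolding good_def by blast
    have "emeasure \<nu> A \<le> (\<integral>\<^sup>+\<omega>. of_nat (\<Sum>i\<in>I. degree (q i)) \<partial>M)"
      unfolding g(2)[symmetric]
    proof (rule nn_integral_mono_AE)
      show "AE \<omega> in M. g \<omega> \<le> of_nat (\<Sum>i\<in>I. degree (q i))"
        using g(1)
      proof eventually_elim
        case (elim \<omega>)
        show ?case using zero_count_rpoly_le[of \<omega> A] unfolding elim[unfolded N_def] .
      qed
    qed
    also have "\<dots> < \<infinity>" by (simp add: emeasure_space_1 ennreal_of_nat_eq_real_of_nat del: of_nat_sum)
    finally show ?thesis .
  qed
  have G: "sets (borel :: complex measure) = sigma_sets UNIV (range (\<lambda>(a, b). box a b))"
    by (subst borel_eq_box) simp
  have "Int_stable (range (\<lambda>(a, b). box a b :: complex set))"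
    "range (\<lambda>(a, b). box a b :: complex set) \<subseteq> Pow UNIV"
    "A \<in> sigma_sets UNIV (range (\<lambda>(a, b). box a b))"
    using assms by (auto simp: Int_stable_def box_Int_box G)
  then have "good A"
  proof (induction rule: sigma_sets_induct_disjoint)
    fix A assume "A \<in> range (\<lambda>(a, b). box a b :: complex set)"
    then show "good A" using good_box by auto
  next
    show "good {}"
      unfolding good_def N_def by (intro bexI[of _ "\<lambda>_. 0"]) (auto simp: zero_count_def)
  next
    fix A assume A: "A \<in> sigma_sets UNIV (range (\<lambda>(a, b). box a b :: complex set))" and gA: "good A"
    from A have [measurable]: "A \<in> sets borel" by (simp add: G)
    obtain g where [measurable]: "g \<in> borel_measurable M" and g: "AE \<omega> in M. N A \<omega> = g \<omega>" "(\<integral>\<^sup>+\<omega>. g \<omega> \<partial>M) = emeasure \<nu> A"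
      using gA unfolding good_def by blast
    obtain u where [measurable]: "u \<in> borel_measurable M" and u: "AE \<omega> in M. N UNIV \<omega> = u \<omega>" "(\<integral>\<^sup>+\<omega>. u \<omega> \<partial>M) = emeasure \<nu> UNIV"
      using good_UNIV unfolding good_def by blast
    have "AE \<omega> in M. N (UNIV - A) \<omega> = u \<omega> - g \<omega>"
      using g(1) u(1) by eventually_elim (simp add: N_def zero_count_Compl Compl_eq_Diff_UNIV[symmetric])
    moreover have "(\<integral>\<^sup>+\<omega>. u \<omega> - g \<omega> \<partial>M) = emeasure \<nu> (UNIV - A)"
    proof -
      have "AE \<omega> in M. g \<omega> \<le> u \<omega>"
        using g(1) u(1) by eventually_elim (metis N_def zero_count_mono subset_UNIV)
      then have "(\<integral>\<^sup>+\<omega>. u \<omega> - g \<omega> \<partial>M) = emeasure \<nu> UNIV - emeasure \<nu> A"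
        using finite_good[OF gA] by (subst nn_integral_diff) (auto simp: g u)
      also have "\<dots> = emeasure \<nu> (UNIV - A)"
        using finite_good[OF gA] by (subst emeasure_Diff) auto
      finally show ?thesis .
    qed
    ultimately show "good (UNIV - A)"
      unfolding good_def by (intro bexI[of _ "\<lambda>\<omega>. u \<omega> - g \<omega>"]) auto
  next
    fix A :: "nat \<Rightarrow> complex set"
    assume disj: "disjoint_family A" and A: "range A \<subseteq> sigma_sets UNIV (range (\<lambda>(a, b). box a b))"
      and gA: "\<And>k. good (A k)"
    from A have rA: "range A \<subseteq> sets \<nu>" by (simp add: G)
    have "\<forall>k. \<exists>g\<in>borel_measurable M. (AE \<omega> in M. N (A k) \<omega> = g \<omega>) \<and> (\<integral>\<^sup>+\<omega>. g \<omega> \<partial>M) = emeasure \<nu> (A k)"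
      using gA unfolding good_def by blast
    then obtain g where g [measurable]: "\<And>k. g k \<in> borel_measurable M"
      and ae: "\<And>k. AE \<omega> in M. N (A k) \<omega> = g k \<omega>" and ig: "\<And>k. (\<integral>\<^sup>+\<omega>. g k \<omega> \<partial>M) = emeasure \<nu> (A k)"
      by metis
    have ae': "AE \<omega> in M. \<forall>k. N (A k) \<omega> = g k \<omega>" using ae by (simp add: AE_all_countable)
    have "AE \<omega> in M. N (\<Union>k. A k) \<omega> = (\<Sum>k. g k \<omega>)"
      using ae' by eventually_elim (simp add: N_def zero_count_UN_disjoint[OF disj])
    moreover have "(\<integral>\<^sup>+\<omega>. (\<Sum>k. g k \<omega>) \<partial>M) = emeasure \<nu> (\<Union>k. A k)"
      by (simp add: nn_integral_suminf ig suminf_emeasure[OF rA disj])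
    ultimately show "good (\<Union>k. A k)"
      unfolding good_def by (intro bexI[of _ "\<lambda>\<omega>. \<Sum>k. g k \<omega>"]) auto
  qed
  then obtain g where g: "AE \<omega> in M. N A \<omega> = g \<omega>" "(\<integral>\<^sup>+\<omega>. g \<omega> \<partial>M) = emeasure \<nu> A"
    unfolding good_def by blast
  have "(\<integral>\<^sup>+\<omega>. zero_count (proots (rpoly \<omega>)) A \<partial>M) = emeasure \<nu> A"
    unfolding g(2)[symmetric] by (rule nn_integral_cong_AE) (use g(1) in \<open>simp add: N_def\<close>)
  also have "\<dots> = (\<integral>\<^sup>+z\<in>A. ennreal (density_of_zeros z) \<partial>lborel)"
    unfolding \<nu>_def using assms by (subst emeasure_density) auto
  finally show ?thesis .
qed

end

section \<open>Orthogonal polynomials with Gaussian coefficients\<close>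

lemma complex_gaussian_family_of_std_normals:
  assumes "prob_space M" and "indep_std_normals M n \<alpha> \<beta>"
  shows "complex_gaussian_family M {..n} (\<lambda>j \<omega>. complex_of_real (\<alpha> j \<omega>) + \<i> * complex_of_real (\<beta> j \<omega>))"
proof -
  interpret prob_space M by fact
  have ind: "indep_vars (\<lambda>_. borel) (case_sum \<alpha> \<beta>) ({..n} <+> {..n})"
    and dist: "\<And>j. j \<le> n \<Longrightarrow> distributed M lborel (\<alpha> j) std_normal_density"
      "\<And>j. j \<le> n \<Longrightarrow> distributed M lborel (\<beta> j) std_normal_density"
    using assms(2) unfolding indep_std_normals_def by auto
  define S where "S j = {Inl j, Inr j :: nat + nat}" for j
  define Y where "Y j f = complex_of_real (f (Inl j)) + \<i> * complex_of_real (f (Inr j))" for j :: nat and f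
  have "indep_vars (\<lambda>j. PiM (S j) (\<lambda>_. borel)) (\<lambda>j \<omega>. restrict (\<lambda>i. case_sum \<alpha> \<beta> i \<omega>) (S j)) {..n}"
    by (rule indep_vars_restrict[OF ind]) (auto simp: S_def disjoint_family_on_def)
  then have "indep_vars (\<lambda>_. borel) (\<lambda>j \<omega>. Y j (restrict (\<lambda>i. case_sum \<alpha> \<beta> i \<omega>) (S j))) {..n}"
  proof (rule indep_vars_compose2)
    fix j
    have [measurable]: "Inl j \<in> S j" "Inr j \<in> S j" by (auto simp: S_def)
    show "Y j \<in> PiM (S j) (\<lambda>_. borel) \<rightarrow>\<^sub>M borel"
      unfolding Y_def by measurable
  qed
  then have indep: "indep_vars (\<lambda>_. borel) (\<lambda>j \<omega>. complex_of_real (\<alpha> j \<omega>) + \<i> * complex_of_real (\<beta> j \<omega>)) {..n}"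
    by (simp add: Y_def S_def)
  have law: "distr M borel (\<lambda>\<omega>. complex_of_real (\<alpha> j \<omega>) + \<i> * complex_of_real (\<beta> j \<omega>)) = cgauss" if j: "j \<le> n" for j
  proof -
    have [measurable]: "\<alpha> j \<in> borel_measurable M" "\<beta> j \<in> borel_measurable M"
      using dist[OF j] by (auto dest: distributed_measurable)
    have "indep_var
      borel ((\<lambda>f. f (Inl j)) \<circ> (\<lambda>\<omega>. restrict (\<lambda>i. case_sum \<alpha> \<beta> i \<omega>) {Inl j}))
      borel ((\<lambda>f. f (Inr j)) \<circ> (\<lambda>\<omega>. restrict (\<lambda>i. case_sum \<alpha> \<beta> i \<omega>) {Inr j}))"
      using j by (intro indep_var_compose[OF indep_var_restrict[OF ind]]) auto
    then have "indep_var borel (\<alpha> j) borel (\<beta> j)" by (simp add: o_def)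
    then have "distr M borel (\<alpha> j) \<Otimes>\<^sub>M distr M borel (\<beta> j) = distr M (borel \<Otimes>\<^sub>M borel) (\<lambda>\<omega>. (\<alpha> j \<omega>, \<beta> j \<omega>))"
      unfolding indep_var_distribution_eq by blast
    moreover have "distr M borel (\<alpha> j) = std_gauss" "distr M borel (\<beta> j) = std_gauss"
      using dist[OF j, THEN distributed_distr_eq_density] by (simp_all cong: distr_cong)
    ultimately have pair: "distr M (borel \<Otimes>\<^sub>M borel) (\<lambda>\<omega>. (\<alpha> j \<omega>, \<beta> j \<omega>)) = std_gauss \<Otimes>\<^sub>M std_gauss" by simp
    have "cgauss = distr (distr M (borel \<Otimes>\<^sub>M borel) (\<lambda>\<omega>. (\<alpha> j \<omega>, \<beta> j \<omega>))) borel (\<lambda>(x, y). Complex x y)"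
      unfolding pair by (rule cgauss_eq_distr)
    also have "\<dots> = distr M borel (\<lambda>\<omega>. complex_of_real (\<alpha> j \<omega>) + \<i> * complex_of_real (\<beta> j \<omega>))"
      by (subst distr_distr) (auto simp: o_def Complex_eq)
    finally show ?thesis ..
  qed
  show ?thesis by standard (use indep law in auto)
qed

theorem theorem2:
  fixes \<mu> :: "real measure" and p :: "nat \<Rightarrow> real poly" and n :: nat
    and M :: "'a measure" and \<alpha> \<beta> :: "nat \<Rightarrow> 'a \<Rightarrow> real"
  assumes "orthogonal_on_real_line \<mu> p"
    and "prob_space M"
    and "indep_std_normals M n \<alpha> \<beta>"
  shows "is_zero_intensity M (random_poly p n \<alpha> \<beta>) (\<lambda>z. Re (hP p n z)) \<and>
    (\<forall>z. Im z \<noteq> 0 \<longrightarrow>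
       Im (poly (cpoly (p (n + 1))) z * poly (cpoly (p n)) (cnj z)) \<noteq> 0 \<and>
       hP p n z = complex_of_real (simplified_hP p n z)) \<and>
    (\<forall>z. Im z = 0 \<longrightarrow>
       ((\<lambda>w. complex_of_real (simplified_hP p n w)) \<longlongrightarrow> hP p n z)
         (at z within {w. Im w \<noteq> 0}))"
proof -
  define \<eta> where "\<eta> j \<omega> = complex_of_real (\<alpha> j \<omega>) + \<i> * complex_of_real (\<beta> j \<omega>)" for j \<omega>
  interpret complex_gaussian_family M "{..n}" \<eta>
    unfolding \<eta>_def by (rule complex_gaussian_family_of_std_normals) fact+
  have "\<exists>i\<in>{..n}. poly (cpoly (p i)) z \<noteq> 0" for z
  proof (intro bexI[of _ 0])
    have "p 0 \<noteq> 0" "degree (p 0) = 0" using assms(1) by (auto simp: orthogonal_on_real_line_def)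
    then obtain a where "p 0 = [:a:]" "a \<noteq> 0" by (metis degree_eq_zeroE pCons_0_0)
    then show "poly (cpoly (p 0)) z \<noteq> 0" by (simp add: poly_cpoly_pCons)
  qed simp
  then interpret gaussian_polynomial M "{..n}" \<eta> "\<lambda>j. cpoly (p j)"
    by unfold_locales
  have K: "K p n z z = of_real (kernel z)" for z
    by (simp add: K_diag kernel_def)
  then have K0: "K p n z z \<noteq> 0" for z using kernel_pos[of z] by simp
  have h: "hP p n z = of_real (density_of_zeros z)" for z
  proof -
    have "K11 p n z z = of_real (kernel11 z)"
      by (simp add: K11_def kernel11_def complex_norm_square[symmetric])
    moreover have "cmod (K01 p n z z) = cmod (kernel10 z)"
    proof -
      have "K01 p n z z = cnj (kernel10 z)" by (simp add: K01_def kernel10_def mult.commute)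
      then show ?thesis by simp
    qed
    ultimately show ?thesis by (simp add: hP_def K density_of_zeros_def)
  qed
  have rpoly: "random_poly p n \<alpha> \<beta> \<omega> = rpoly \<omega>" for \<omega>
    by (simp add: random_poly_def rpoly_def \<eta>_def)
  have "is_zero_intensity M (random_poly p n \<alpha> \<beta>) (\<lambda>z. Re (hP p n z))"
    unfolding is_zero_intensity_def h rpoly Re_complex_of_real
    using expected_zeros density_of_zeros_nonneg
      borel_measurable_continuous_onI[OF continuous_density_of_zeros]
    by (simp add: zero_count_def)
  then show ?thesis
    using hP_eq_simplified[OF assms(1) _ K0] tendsto_simplified_hP[OF assms(1) K0] by simp
qed

end
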